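(* Let $H$ be an infinite dimensional real or complex Hilbert space and let $1<n\in\mathbb N$. If $\phi:P_n(H)\to P_n(H)$ is a map such that $\angle(\phi(P),\phi(Q))=\angle(P,Q)$ for all $P,Q\in P_n(H)$, then there exists a linear or conjugate-linear isometry $V$ on $H$ such that $\phi(P)=VPV^*$ for all $P\in P_n(H)$.
   Context: A projection means a self-adjoint idempotent bounded operator on $H$; $P_n(H)$ is the set of all rank-$n$ projections. For projections $P,Q,P',Q'$, "$\angle(P,Q)=\angle(P',Q')$" means by definition that the positive operators $QPQ$ and $Q'P'Q'$ are unitarily equivalent (orthogonally equivalent in the real case). For a conjugate-linear $V$, $V^*$ denotes the conjugate-linear operator with $\langle Vx,y\rangle=\overline{\langle x,V^*y\rangle}$; an isometry means $\|Vx\|=\|x\|$ for all $x$. *)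

theory Defs
  imports "HOL-Analysis.Analysis"
begin

definition r_infinite_dim :: "'a::real_inner itself \<Rightarrow> bool" where
  "r_infinite_dim _ \<longleftrightarrow> \<not> (\<exists>B::'a set. finite B \<and> span B = UNIV)"

definition r_projection :: "('a::real_inner \<Rightarrow> 'a) \<Rightarrow> bool" where
  "r_projection P \<longleftrightarrow> bounded_linear P \<and> P \<circ> P = P \<and> (\<forall>x y. inner (P x) y = inner x (P y))"

definition r_rank_eq :: "('a::real_inner \<Rightarrow> 'a) \<Rightarrow> nat \<Rightarrow> bool" where
  "r_rank_eq T n \<longleftrightarrow> (\<exists>B. finite B \<and> card B = n \<and> independent B \<and> span B = range T)"

definition r_Proj :: "nat \<Rightarrow> ('a::real_inner \<Rightarrow> 'a) set" where
  "r_Proj n = {P. r_projection P \<and> r_rank_eq P n}"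

definition r_orthogonal :: "('a::real_inner \<Rightarrow> 'a) \<Rightarrow> bool" where
  "r_orthogonal U \<longleftrightarrow> linear U \<and> (\<forall>x. norm (U x) = norm x) \<and> surj U"

text \<open>B = U A U^* for some orthogonal U, written as B o U = U o A\<close>
definition r_equiv :: "('a::real_inner \<Rightarrow> 'a) \<Rightarrow> ('a \<Rightarrow> 'a) \<Rightarrow> bool" where
  "r_equiv A B \<longleftrightarrow> (\<exists>U. r_orthogonal U \<and> B \<circ> U = U \<circ> A)"

definition r_angle_eq :: "('a::real_inner \<Rightarrow> 'a) \<Rightarrow> ('a \<Rightarrow> 'a) \<Rightarrow> ('a \<Rightarrow> 'a) \<Rightarrow> ('a \<Rightarrow> 'a) \<Rightarrow> bool" where
  "r_angle_eq P Q P' Q' \<longleftrightarrow> r_equiv (Q \<circ> P \<circ> Q) (Q' \<circ> P' \<circ> Q')"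

class complex_inner = real_inner +
  fixes scaleC :: "complex \<Rightarrow> 'a \<Rightarrow> 'a" (infixr "*\<^sub>C" 75)
    and cinner :: "'a \<Rightarrow> 'a \<Rightarrow> complex"
  assumes scaleC_add_right: "a *\<^sub>C (x + y) = a *\<^sub>C x + a *\<^sub>C y"
    and scaleC_add_left: "(a + b) *\<^sub>C x = a *\<^sub>C x + b *\<^sub>C x"
    and scaleC_scaleC: "a *\<^sub>C (b *\<^sub>C x) = (a * b) *\<^sub>C x"
    and scaleC_one: "1 *\<^sub>C x = x"
    and scaleR_scaleC: "scaleR r x = complex_of_real r *\<^sub>C x"
    and cinner_add_right: "cinner x (y + z) = cinner x y + cinner x z"
    and cinner_scaleC_right: "cinner x (a *\<^sub>C y) = a * cinner x y"
    and cinner_commute: "cinner y x = cnj (cinner x y)"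
    and inner_is_Re_cinner: "inner x y = Re (cinner x y)"

definition c_span :: "'a::complex_inner set \<Rightarrow> 'a set" where
  "c_span B = {x. \<exists>S c. finite S \<and> S \<subseteq> B \<and> x = (\<Sum>b\<in>S. c b *\<^sub>C b)}"

definition c_independent :: "'a::complex_inner set \<Rightarrow> bool" where
  "c_independent B \<longleftrightarrow> (\<forall>S c. finite S \<and> S \<subseteq> B \<and> (\<Sum>b\<in>S. c b *\<^sub>C b) = 0 \<longrightarrow> (\<forall>b\<in>S. c b = 0))"

definition c_infinite_dim :: "'a::complex_inner itself \<Rightarrow> bool" where
  "c_infinite_dim _ \<longleftrightarrow> \<not> (\<exists>B::'a set. finite B \<and> c_span B = UNIV)"

definition c_linear :: "('a::complex_inner \<Rightarrow> 'a) \<Rightarrow> bool" where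
  "c_linear T \<longleftrightarrow> (\<forall>x y. T (x + y) = T x + T y) \<and> (\<forall>a x. T (a *\<^sub>C x) = a *\<^sub>C T x)"

definition c_antilinear :: "('a::complex_inner \<Rightarrow> 'a) \<Rightarrow> bool" where
  "c_antilinear T \<longleftrightarrow> (\<forall>x y. T (x + y) = T x + T y) \<and> (\<forall>a x. T (a *\<^sub>C x) = cnj a *\<^sub>C T x)"

definition c_bounded :: "('a::complex_inner \<Rightarrow> 'a) \<Rightarrow> bool" where
  "c_bounded T \<longleftrightarrow> (\<exists>K. \<forall>x. norm (T x) \<le> norm x * K)"

definition c_projection :: "('a::complex_inner \<Rightarrow> 'a) \<Rightarrow> bool" where
  "c_projection P \<longleftrightarrow> c_linear P \<and> c_bounded P \<and> P \<circ> P = P \<and> (\<forall>x y. cinner (P x) y = cinner x (P y))"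

definition c_rank_eq :: "('a::complex_inner \<Rightarrow> 'a) \<Rightarrow> nat \<Rightarrow> bool" where
  "c_rank_eq T n \<longleftrightarrow> (\<exists>B. finite B \<and> card B = n \<and> c_independent B \<and> c_span B = range T)"

definition c_Proj :: "nat \<Rightarrow> ('a::complex_inner \<Rightarrow> 'a) set" where
  "c_Proj n = {P. c_projection P \<and> c_rank_eq P n}"

definition c_unitary :: "('a::complex_inner \<Rightarrow> 'a) \<Rightarrow> bool" where
  "c_unitary U \<longleftrightarrow> c_linear U \<and> (\<forall>x. norm (U x) = norm x) \<and> surj U"

definition c_equiv :: "('a::complex_inner \<Rightarrow> 'a) \<Rightarrow> ('a \<Rightarrow> 'a) \<Rightarrow> bool" where
  "c_equiv A B \<longleftrightarrow> (\<exists>U. c_unitary U \<and> B \<circ> U = U \<circ> A)"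

definition c_angle_eq :: "('a::complex_inner \<Rightarrow> 'a) \<Rightarrow> ('a \<Rightarrow> 'a) \<Rightarrow> ('a \<Rightarrow> 'a) \<Rightarrow> ('a \<Rightarrow> 'a) \<Rightarrow> bool" where
  "c_angle_eq P Q P' Q' \<longleftrightarrow> c_equiv (Q \<circ> P \<circ> Q) (Q' \<circ> P' \<circ> Q')"

end

theory Submission
  imports Defs
begin

text \<open>
  Both scalar fields are treated at once: a real inner product space carries a skew operator \<open>J\<close> with
  \<open>J\<^sup>2 = - s\<close>, where \<open>s = 0\<close> forces \<open>J = 0\<close> (real case) and \<open>s = 1\<close> makes \<open>J\<close> the multiplication by
  the imaginary unit; traces are real traces.

  Given a unit vector \<open>x\<close>, take rank-\<open>n\<close> projections \<open>M k\<close> onto the sum of the line of \<open>x\<close> and mutually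
  orthogonal blocks.  Angle preservation makes the \<open>\<phi> (M k)\<close> commute with pairwise products of rank one;
  by finite dimensionality infinitely many of them share one line, spanned by \<open>u\<close> say, and are
  orthogonal apart from it.  Letting \<open>k\<close> tend to infinity in the trace identities, Bessel's inequality
  removes the blocks, so \<open>|\<phi> N u| = |N x|\<close> for every \<open>N\<close>.  Hence \<open>x \<mapsto> u\<close> preserves transition
  probabilities and maps the range of \<open>N\<close> into the range of \<open>\<phi> N\<close>.

  Wigner's theorem for not necessarily surjective maps then gives \<open>V\<close>: fix a unit vector \<open>e\<close> and, for \<open>y\<close>
  orthogonal to \<open>e\<close>, choose the representative \<open>e' + T y\<close> of the image of the ray of \<open>e + y\<close>.  Comparing
  \<open>|1 + \<langle>y, z\<rangle>|\<close> with \<open>|\<langle>y, z\<rangle>|\<close> shows that \<open>T\<close> preserves real parts of inner products.  Finally \<open>\<phi> P\<close>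
  and \<open>V P V\<^sup>*\<close> are projections with nested ranges and equal traces.
\<close>

section \<open>Traces of finite-rank projections\<close>

definition orth_proj :: "('a::real_inner \<Rightarrow> 'a) \<Rightarrow> bool" where
  "orth_proj P \<longleftrightarrow> linear P \<and> (\<forall>x. P (P x) = P x) \<and> (\<forall>x y. inner (P x) y = inner x (P y))"

definition finite_rank :: "('a::real_inner \<Rightarrow> 'a) \<Rightarrow> bool" where
  "finite_rank T \<longleftrightarrow> (\<exists>B. finite B \<and> range T \<subseteq> span B)"

definition orthonormal :: "'a::real_inner set \<Rightarrow> bool" where
  "orthonormal C \<longleftrightarrow> finite C \<and> pairwise orthogonal C \<and> (\<forall>c\<in>C. norm c = 1)"

text \<open>The choice is irrelevant for self-adjoint \<open>T\<close> of finite rank, see \<open>op_trace_eq\<close>.\<close>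
definition op_trace :: "('a::real_inner \<Rightarrow> 'a) \<Rightarrow> real" where
  "op_trace T = (\<Sum>c\<in>(SOME C. orthonormal C \<and> range T \<subseteq> span C). inner c (T c))"

lemma orthonormal_inner:
  "orthonormal C \<Longrightarrow> c \<in> C \<Longrightarrow> d \<in> C \<Longrightarrow> inner c d = (if c = d then 1 else 0)"
  by (auto simp: orthonormal_def pairwise_def orthogonal_def power2_norm_eq_inner[symmetric])

lemma orthonormal_span_exists:
  fixes B :: "'a::real_inner set"
  assumes "finite B"
  shows "\<exists>C. orthonormal C \<and> span C = span B"
proof -
  obtain C where C: "finite C" "span C = span B" "pairwise orthogonal C"
    using basis_orthogonal[OF assms] by blast
  define D where "D = (\<lambda>c. c /\<^sub>R norm c) ` (C - {0})"
  have "orthonormal D"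
    using C by (auto simp: orthonormal_def D_def pairwise_def orthogonal_def)
  moreover have "span D = span (C - {0})"
    unfolding D_def
    by (rule span_image_scale) (use C in auto)
  moreover have "span (C - {0}) = span C"
    by (rule span_delete_0)
  ultimately show ?thesis using C by auto
qed

lemma orthonormal_expansion:
  assumes C: "orthonormal C" and x: "x \<in> span C"
  shows "x = (\<Sum>c\<in>C. inner c x *\<^sub>R c)"
  using x
proof (induction rule: span_induct_alt)
  case base
  then show ?case by simp
next
  case (step a c x)
  have fin: "finite C" using C by (simp add: orthonormal_def)
  have "(\<Sum>d\<in>C. inner d (a *\<^sub>R c + x) *\<^sub>R d)
      = (\<Sum>d\<in>C. (a * inner d c) *\<^sub>R d) + (\<Sum>d\<in>C. inner d x *\<^sub>R d)"
    by (simp add: inner_add_right scaleR_add_left sum.distrib)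
  also have "(\<Sum>d\<in>C. (a * inner d c) *\<^sub>R d) = (\<Sum>d\<in>C. if d = c then a *\<^sub>R c else 0)"
    using step(1) by (intro sum.cong) (auto simp: orthonormal_inner[OF C])
  also have "\<dots> = a *\<^sub>R c" using fin step(1) by simp
  finally show ?case using step by simp
qed

lemma orthonormal_parseval:
  assumes C: "orthonormal C" and x: "x \<in> span C"
  shows "inner x y = (\<Sum>c\<in>C. inner c x * inner c y)"
  using arg_cong[OF orthonormal_expansion[OF C x], of "\<lambda>z. inner z y"]
  by (simp add: inner_sum_left)

text \<open>Expand each \<open>T c\<close> in the chosen family \<open>D\<close>, swap the two sums,
  move \<open>T\<close> across by self-adjointness, and sum over \<open>C\<close> again by
  Parseval.\<close>

lemma op_trace_eq:
  assumes sa: "\<And>x y. inner (T x) y = inner x (T y)"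
    and C: "orthonormal C" "range T \<subseteq> span C"
  shows "op_trace T = (\<Sum>c\<in>C. inner c (T c))"
proof -
  define D where "D = (SOME C. orthonormal C \<and> range T \<subseteq> span C)"
  have D: "orthonormal D" "range T \<subseteq> span D"
    using someI[of "\<lambda>C. orthonormal C \<and> range T \<subseteq> span C" C] C by (auto simp: D_def)
  have "(\<Sum>c\<in>C. inner c (T c)) = (\<Sum>c\<in>C. \<Sum>d\<in>D. inner d (T c) * inner d c)"
    by (intro sum.cong refl, subst inner_commute, rule orthonormal_parseval[OF D(1)]) (use D in auto)
  also have "\<dots> = (\<Sum>d\<in>D. \<Sum>c\<in>C. inner d (T c) * inner d c)"
    by (rule sum.swap)
  also have "\<dots> = (\<Sum>d\<in>D. \<Sum>c\<in>C. inner c (T d) * inner c d)"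
    by (intro sum.cong refl) (metis inner_commute sa)
  also have "\<dots> = (\<Sum>d\<in>D. inner (T d) d)"
    using C by (intro sum.cong) (auto intro!: orthonormal_parseval[symmetric])
  finally show ?thesis by (simp add: op_trace_def D_def inner_commute)
qed

lemma finite_rank_orthonormal:
  assumes "finite_rank T"
  obtains C where "orthonormal C" "range T \<subseteq> span C"
proof -
  obtain B where "finite B" "range T \<subseteq> span B" using assms by (auto simp: finite_rank_def)
  then show ?thesis using orthonormal_span_exists[of B] that by metis
qed

lemma finite_rank_diff:
  assumes "finite_rank S" "finite_rank T"
  shows "finite_rank (\<lambda>x. S x - T x)"
proof -
  obtain A B where AB: "finite A" "range S \<subseteq> span A" "finite B" "range T \<subseteq> span B"
    using assms by (auto simp: finite_rank_def)
  have "S x - T x \<in> span (A \<union> B)" for x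
  proof (rule span_diff)
    show "S x \<in> span (A \<union> B)" using AB span_mono[of A "A \<union> B"] by blast
    show "T x \<in> span (A \<union> B)" using AB span_mono[of B "A \<union> B"] by blast
  qed
  then show ?thesis using AB unfolding finite_rank_def by (intro exI[of _ "A \<union> B"]) auto
qed

lemma finite_rank_comp_left: "finite_rank S \<Longrightarrow> finite_rank (S \<circ> T)"
  by (auto simp: finite_rank_def)

lemma op_trace_diff:
  assumes S: "\<And>x y. inner (S x) y = inner x (S y)" "finite_rank S"
    and T: "\<And>x y. inner (T x) y = inner x (T y)" "finite_rank T"
  shows "op_trace (\<lambda>x. S x - T x) = op_trace S - op_trace T"
proof -
  obtain A B where AB: "finite A" "range S \<subseteq> span A" "finite B" "range T \<subseteq> span B"
    using S T by (auto simp: finite_rank_def)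
  obtain C where C: "orthonormal C" "span C = span (A \<union> B)"
    using orthonormal_span_exists[of "A \<union> B"] AB by auto
  have r: "range S \<subseteq> span C" "range T \<subseteq> span C"
    using AB C span_mono[of A "A \<union> B"] span_mono[of B "A \<union> B"] by auto
  then have "range (\<lambda>x. S x - T x) \<subseteq> span C" by (auto intro!: span_diff)
  then show ?thesis
    using op_trace_eq[OF _ C(1), of "\<lambda>x. S x - T x"] op_trace_eq[OF S(1) C(1) r(1)]
      op_trace_eq[OF T(1) C(1) r(2)] S T
    by (simp add: inner_diff_left inner_diff_right sum_subtractf)
qed

text \<open>Polarization: compare the squared norms of \<open>U (x + y)\<close> and
  \<open>x + y\<close>.\<close>

lemma orthogonal_map_inner:
  assumes "linear U" "\<And>x. norm (U x) = norm x"
  shows "inner (U x) (U y) = inner x y"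
proof -
  have "norm (U (x + y))^2 = norm (x + y)^2" using assms by simp
  then show ?thesis
    unfolding linear_add[OF assms(1)]
    using arg_cong[OF assms(2)[of x], of "\<lambda>t. t^2"] arg_cong[OF assms(2)[of y], of "\<lambda>t. t^2"]
    by (simp add: power2_norm_eq_inner inner_add_left inner_add_right inner_commute)
qed

text \<open>The squared norm of the defect of additivity or homogeneity expands into inner products
  of values of \<open>f\<close> on \<open>E\<close>, and these cancel.\<close>

lemma inner_preserving_linear_on:
  assumes E: "subspace E" and f: "\<And>x y. x \<in> E \<Longrightarrow> y \<in> E \<Longrightarrow> inner (f x) (f y) = inner x y"
  shows "x \<in> E \<Longrightarrow> y \<in> E \<Longrightarrow> f (x + y) = f x + f y" and "x \<in> E \<Longrightarrow> f (c *\<^sub>R x) = c *\<^sub>R f x"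
proof -
  assume x: "x \<in> E"
  note E_simps = subspace_add[OF E] subspace_scale[OF E]
  have "inner (f (c *\<^sub>R x) - c *\<^sub>R f x) (f (c *\<^sub>R x) - c *\<^sub>R f x) = 0"
    using x by (simp add: inner_diff_left inner_diff_right f E_simps)
  then show "f (c *\<^sub>R x) = c *\<^sub>R f x" by simp
  assume y: "y \<in> E"
  have "inner (f (x + y) - (f x + f y)) (f (x + y) - (f x + f y)) = 0"
    using x y by (simp add: inner_diff_left inner_diff_right inner_add_left inner_add_right f E_simps)
  then show "f (x + y) = f x + f y" by simp
qed

text \<open>\<open>U\<close> carries an orthonormal family for the range of \<open>A\<close> to one
  for the range of \<open>B\<close>, with the same diagonal entries. The condition
  \<open>range_B\<close> takes the place of surjectivity, so that the Wigner isometry can serve as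
  \<open>U\<close>.\<close>

lemma op_trace_isometry:
  assumes U: "linear U" "\<And>x. norm (U x) = norm x"
    and BU: "\<And>x. B (U x) = U (A x)" and range_B: "range B \<subseteq> U ` range A"
    and A: "\<And>x y. inner (A x) y = inner x (A y)" "finite_rank A"
    and B: "\<And>x y. inner (B x) y = inner x (B y)"
  shows "op_trace A = op_trace B"
proof -
  note UU = orthogonal_map_inner[OF U]
  obtain C where C: "orthonormal C" "range A \<subseteq> span C" using finite_rank_orthonormal[OF A(2)] .
  have inj: "inj U"
  proof (rule injI)
    fix x y assume "U x = U y"
    then have "norm (U (x - y)) = 0" by (simp add: linear_diff[OF U(1)])
    then show "x = y" by (simp add: U(2))
  qed
  have UC: "orthonormal (U ` C)"
    using C inj unfolding orthonormal_def by (auto simp: pairwise_def orthogonal_def UU U(2))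
  have "range B \<subseteq> span (U ` C)"
    using range_B C(2) by (auto simp: linear_span_image[OF U(1)])
  then have "op_trace B = (\<Sum>c\<in>U ` C. inner c (B c))"
    by (intro op_trace_eq B UC)
  also have "\<dots> = (\<Sum>c\<in>C. inner c (A c))"
    using inj by (subst sum.reindex) (auto simp: BU UU intro: inj_on_subset)
  also have "\<dots> = op_trace A" using op_trace_eq[OF A(1) C] by simp
  finally show ?thesis by simp
qed

lemma op_trace_equiv:
  assumes eq: "r_equiv A B"
    and A: "\<And>x y. inner (A x) y = inner x (A y)" "finite_rank A"
    and B: "\<And>x y. inner (B x) y = inner x (B y)"
  shows "op_trace A = op_trace B"
proof -
  obtain U where U: "linear U" "\<And>x. norm (U x) = norm x" "surj U" and BU: "\<And>x. B (U x) = U (A x)"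
    using eq by (auto simp: r_equiv_def r_orthogonal_def fun_eq_iff)
  have "range B \<subseteq> U ` range A"
    using U(3) BU by (metis (no_types, lifting) image_subsetI rangeI rev_image_eqI surjD)
  then show ?thesis using op_trace_isometry[OF U(1,2) BU _ A B] by blast
qed

lemma equiv_idempotent:
  assumes eq: "r_equiv A B" and A: "\<And>x. B (B x) = B x"
  shows "A (A x) = A x"
proof -
  obtain U where U: "linear U" "\<And>x. norm (U x) = norm x" and BU: "\<And>x. B (U x) = U (A x)"
    using eq by (auto simp: r_equiv_def r_orthogonal_def fun_eq_iff)
  have "U (A (A x)) = U (A x)" by (simp flip: BU add: A)
  then have "norm (U (A (A x) - A x)) = 0" by (simp add: linear_diff[OF U(1)])
  then show ?thesis by (simp add: U(2))
qed

section \<open>Algebra of orthogonal projections\<close>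

lemma orth_proj_linear: "orth_proj P \<Longrightarrow> linear P"
  and orth_proj_idem: "orth_proj P \<Longrightarrow> P (P x) = P x"
  and orth_proj_sa: "orth_proj P \<Longrightarrow> inner (P x) y = inner x (P y)"
  by (auto simp: orth_proj_def)

lemma orth_proj_inner_self: "orth_proj P \<Longrightarrow> inner x (P x) = (norm (P x))\<^sup>2"
  by (metis orth_proj_def power2_norm_eq_inner)

lemma orth_proj_pythagoras:
  assumes "orth_proj P" shows "(norm (x - P x))\<^sup>2 = (norm x)\<^sup>2 - (norm (P x))\<^sup>2"
  using orth_proj_inner_self[OF assms, of x]
  by (simp add: power2_norm_eq_inner inner_diff_left inner_diff_right inner_commute)

lemma orth_proj_norm_le: "orth_proj P \<Longrightarrow> norm (P x) \<le> norm x"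
  using orth_proj_pythagoras[of P x]
  by (metis diff_ge_0_iff_ge norm_ge_zero power2_le_imp_le zero_le_power2)

lemma orth_proj_fixes: "orth_proj P \<Longrightarrow> norm (P x) = norm x \<Longrightarrow> P x = x"
  using orth_proj_pythagoras[of P x] by simp

lemma orth_proj_absorb_right:
  assumes "orth_proj P" "orth_proj Q" and "\<And>x. Q (P x) = P x"
  shows "P (Q x) = P x"
proof -
  have "inner (P (Q x) - P x) y = 0" for y
    using assms by (simp add: inner_diff_left orth_proj_sa)
  then show ?thesis by (metis eq_iff_diff_eq_0 inner_eq_zero_iff)
qed

lemma orth_proj_diff:
  assumes "orth_proj P" "orth_proj Q" and "\<And>x. Q (P x) = P x"
  shows "orth_proj (\<lambda>x. Q x - P x)"
  using assms(1,2)
  by (simp add: orth_proj_def[of "\<lambda>x. Q x - P x"])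
    (simp add: assms(3) orth_proj_absorb_right[OF assms] orth_proj_sa orth_proj_idem inner_diff_left
      inner_diff_right linear_diff[OF orth_proj_linear] linear_compose_sub orth_proj_linear)

text \<open>\<open>Q - P\<close> is again a projection. Its trace is a sum of squared norms over an
  orthonormal family whose span contains its range, so trace zero makes it vanish on that span and,
  being idempotent, everywhere.\<close>

lemma orth_proj_ext:
  assumes "orth_proj P" "orth_proj Q" "finite_rank P" "finite_rank Q"
    and le: "\<And>x. Q (P x) = P x" and tr: "op_trace P = op_trace Q"
  shows "P = Q"
proof -
  define D where "D = (\<lambda>x. Q x - P x)"
  have D: "orth_proj D"
    unfolding D_def using assms by (intro orth_proj_diff)
  have fD: "finite_rank D" unfolding D_def using assms by (intro finite_rank_diff)
  obtain C where C: "orthonormal C" "range D \<subseteq> span C" using finite_rank_orthonormal[OF fD] .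
  have "op_trace D = 0"
    unfolding D_def using assms by (subst op_trace_diff) (auto simp: orth_proj_sa)
  then have "(\<Sum>c\<in>C. (norm (D c))\<^sup>2) = 0"
    using op_trace_eq[OF orth_proj_sa[OF D] C] by (simp add: orth_proj_inner_self[OF D])
  then have Dc: "D c = 0" if "c \<in> C" for c
    using that C by (subst (asm) sum_nonneg_eq_0_iff) (auto simp: orthonormal_def)
  have "D x = 0" for x
  proof -
    have "D x \<in> span C" using C by auto
    then have "D (D x) = 0"
      by (rule linear_eq_0_on_span[OF orth_proj_linear[OF D] Dc, rotated])
    then show ?thesis by (simp add: orth_proj_idem[OF D])
  qed
  then show ?thesis by (auto simp: D_def fun_eq_iff)
qed

text \<open>In this form the trace is a finite sum of squared norms, so pointwise limits of
  \<open>norm (P c)\<close> pass to it.\<close>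

lemma op_trace_compress:
  assumes "orth_proj P" "orth_proj Q" "orthonormal C" "range Q \<subseteq> span C"
  shows "op_trace (Q \<circ> P \<circ> Q) = (\<Sum>c\<in>C. (norm (P (Q c)))\<^sup>2)"
proof -
  have "op_trace (Q \<circ> P \<circ> Q) = (\<Sum>c\<in>C. inner c ((Q \<circ> P \<circ> Q) c))"
    using assms by (intro op_trace_eq) (auto simp: orth_proj_sa)
  also have "\<dots> = (\<Sum>c\<in>C. (norm (P (Q c)))\<^sup>2)"
    by (intro sum.cong refl) (simp add: orth_proj_sa[OF assms(2), symmetric] orth_proj_inner_self[OF assms(1)])
  finally show ?thesis .
qed

text \<open>Idempotency of the compression shows that \<open>P (Q x)\<close> has the same norm as
  its projection \<open>Q (P (Q x))\<close>, so \<open>Q\<close> fixes it. Thus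
  \<open>Q P Q = P Q\<close>, and taking adjoints gives \<open>P Q = Q P\<close>.\<close>

lemma orth_proj_commute:
  assumes P: "orth_proj P" and Q: "orth_proj Q"
    and idem: "\<And>x. Q (P (Q (Q (P (Q x))))) = Q (P (Q x))"
  shows "P (Q x) = Q (P x)"
proof -
  have PQ: "P (Q x) = Q (P (Q x))" for x
  proof -
    have "(norm (P (Q x)))\<^sup>2 = inner (Q x) (P (Q x))"
      by (simp add: orth_proj_inner_self[OF P])
    also have "\<dots> = inner x (Q (P (Q x)))" by (simp add: orth_proj_sa[OF Q])
    also have "\<dots> = inner x (Q (P (Q (Q (P (Q x))))))" by (simp add: idem)
    also have "\<dots> = (norm (Q (P (Q x))))\<^sup>2"
      by (simp add: orth_proj_sa[OF P] orth_proj_sa[OF Q] power2_norm_eq_inner)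
    finally have "norm (Q (P (Q x))) = norm (P (Q x))" by simp
    then show ?thesis using orth_proj_fixes[OF Q] by metis
  qed
  have "inner (P (Q x) - Q (P x)) y = 0" for y
    using PQ[of x] PQ[of y]
    by (simp add: inner_diff_left orth_proj_sa[OF P] orth_proj_sa[OF Q])
      (metis orth_proj_sa P Q)
  then show ?thesis by (metis eq_iff_diff_eq_0 inner_eq_zero_iff)
qed

lemma orth_proj_comp:
  assumes P: "orth_proj P" and Q: "orth_proj Q" and c: "\<And>x. P (Q x) = Q (P x)"
  shows "orth_proj (P \<circ> Q)"
  using assms unfolding orth_proj_def by (auto intro: linear_compose)

text \<open>Bessel's inequality bounds the partial sums of the squared norms by that of
  \<open>c\<close>, so the series converges and its terms tend to zero.\<close>

lemma orthogonal_projections_tendsto_0: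
  assumes R: "\<And>k. orth_proj (R k)" and orth: "\<And>k l x. k \<noteq> l \<Longrightarrow> R k (R l x) = 0"
  shows "(\<lambda>k. (norm (R (k::nat) c))\<^sup>2) \<longlonglongrightarrow> 0"
proof (rule summable_LIMSEQ_zero, rule summableI_nonneg_bounded)
  fix m
  let ?S = "\<Sum>k<m. R k c"
  have "inner ?S ?S = (\<Sum>k<m. \<Sum>l<m. inner (R k c) (R l c))"
    by (simp add: inner_sum_left inner_sum_right inner_commute)
  also have "\<dots> = (\<Sum>k<m. \<Sum>l<m. if l = k then (norm (R k c))\<^sup>2 else 0)"
    by (intro sum.cong refl) (auto simp: orth_proj_sa[OF R] orth orth_proj_idem[OF R]
       orth_proj_inner_self[OF R])
  finally have SS: "inner ?S ?S = (\<Sum>k<m. (norm (R k c))\<^sup>2)" by simp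
  have cS: "inner c ?S = (\<Sum>k<m. (norm (R k c))\<^sup>2)"
    by (simp add: inner_sum_right orth_proj_inner_self[OF R])
  have "0 \<le> inner (c - ?S) (c - ?S)" by simp
  then show "(\<Sum>k<m. (norm (R k c))\<^sup>2) \<le> (norm c)\<^sup>2"
    using SS cS by (simp add: inner_diff_left inner_diff_right inner_commute power2_norm_eq_inner)
qed simp

text \<open>Completeness is used here, through the projection theorem for the range of
  \<open>V\<close>: \<open>W y\<close> is the point \<open>x\<close> whose image \<open>V x\<close>
  is nearest to \<open>y\<close>, found as the limit of a minimizing sequence.\<close>

lemma isometry_adjoint_exists:
  fixes V :: "'a::{real_inner,complete_space} \<Rightarrow> 'a"
  assumes V: "linear V" "\<And>x. norm (V x) = norm x"
  shows "\<exists>W. \<forall>x y. inner (V x) y = inner x (W y)"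
proof -
  have "\<exists>x. \<forall>h. inner (V h) y = inner h x" for y
  proof -
    note VV = orthogonal_map_inner[OF V]
    define q where "q = (\<lambda>x. (norm (y - V x))\<^sup>2)"
    define m where "m = (INF x. q x)"
    have bdd: "bdd_below (range q)" by (rule bdd_belowI[of _ 0]) (auto simp: q_def)
    have mq: "m \<le> q x" for x unfolding m_def using bdd by (intro cINF_lower) auto
    have "\<exists>x. q x < m + 1 / real (Suc k)" for k
    proof -
      have "\<exists>z\<in>range q. z < m + 1 / real (Suc k)"
        using cInf_less_iff[of "range q" "m + 1 / real (Suc k)"] bdd by (simp add: m_def)
      then show ?thesis by auto
    qed
    then obtain X where X: "\<And>k. q (X k) < m + 1 / real (Suc k)" by metis
    text \<open>Parallelogram law: \<open>|x - z|\<^sup>2 = 2 q x + 2 q z - 4 q ((x + z) / 2)\<close>.\<close>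
    have par: "(norm (x - z))\<^sup>2 \<le> 2 * (q x - m) + 2 * (q z - m)" for x z
    proof -
      define w where "w = (1/2) *\<^sub>R (x + z)"
      have "(norm (x - z))\<^sup>2 = 2 * q x + 2 * q z - 4 * q w"
        unfolding w_def q_def power2_norm_eq_inner
        by (simp add: linear_add[OF V(1)] linear_scale[OF V(1)] inner_simps VV inner_commute)
          (simp add: algebra_simps VV inner_commute)
      then show ?thesis using mq[of w] by argo
    qed
    have "Cauchy X"
    proof (rule metric_CauchyI)
      fix e :: real assume e: "e > 0"
      obtain K where K: "1 / real (Suc K) < e\<^sup>2 / 4"
        using nat_approx_posE[of "e\<^sup>2 / 4"] e by auto
      have "dist (X i) (X j) < e" if "i \<ge> K" "j \<ge> K" for i j
      proof -
        have b: "q (X k) - m < e\<^sup>2 / 4" if "k \<ge> K" for k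
        proof -
          have "1 / real (Suc k) \<le> 1 / real (Suc K)" using that by (simp add: frac_le)
          then show ?thesis using X[of k] K by linarith
        qed
        have "(norm (X i - X j))\<^sup>2 < e\<^sup>2" using par[of "X i" "X j"] b[OF that(1)] b[OF that(2)] by argo
        then show ?thesis using e by (simp add: dist_norm power2_less_imp_less)
      qed
      then show "\<exists>M. \<forall>i\<ge>M. \<forall>j\<ge>M. dist (X i) (X j) < e" by blast
    qed
    then obtain x where x: "X \<longlonglongrightarrow> x" using Cauchy_convergent_iff convergent_def by blast
    have bl: "bounded_linear V" using V by (intro bounded_linear_intro[of V 1]) (auto simp: linear_add linear_scale)
    have "(\<lambda>k. q (X k)) \<longlonglongrightarrow> q x"
      unfolding q_def by (intro tendsto_intros bounded_linear.tendsto[OF bl] x)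
    moreover have "(\<lambda>k. m + 1 / real (Suc k)) \<longlonglongrightarrow> m + 0"
      by (intro tendsto_intros) (use LIMSEQ_Suc[OF lim_1_over_n] in simp)
    ultimately have "q x \<le> m + 0" by (rule LIMSEQ_le) (use X less_imp_le in blast)
    then have min: "q x \<le> q z" for z using mq[of z] by linarith
    have "inner (V h) (y - V x) = 0" for h
    proof (rule ccontr)
      let ?p = "inner (V h) (y - V x)"
      assume p: "?p \<noteq> 0"
      then have hh: "inner h h > 0" using V(2)[of h] by (metis inner_gt_zero_iff inner_zero_left norm_eq_zero)
      \<comment> \<open>The minimizer in \<open>t\<close> of the quadratic
        \<open>q (x + t h)\<close>; its value there lies below \<open>q x\<close> by the square of
        \<open>?p\<close> over \<open>inner h h\<close>.\<close>
      let ?t = "?p / inner h h"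
      have "q (x + t *\<^sub>R h) = q x - 2 * t * ?p + t\<^sup>2 * inner h h" for t
        unfolding q_def power2_norm_eq_inner
        by (simp add: linear_add[OF V(1)] linear_scale[OF V(1)] inner_simps VV inner_commute
            power2_eq_square algebra_simps)
      then have "q (x + ?t *\<^sub>R h) = q x - 2 * ?t * ?p + ?t\<^sup>2 * inner h h" .
      also have "\<dots> = q x - ?p\<^sup>2 / inner h h" using hh by (simp add: power2_eq_square field_simps)
      finally have "?p\<^sup>2 / inner h h \<le> 0" using min[of "x + ?t *\<^sub>R h"] by simp
      moreover have "?p\<^sup>2 / inner h h > 0" using p hh by simp
      ultimately show False by linarith
    qed
    then show ?thesis by (intro exI[of _ x]) (auto simp: inner_diff_right VV)
  qed
  then show ?thesis by metis
qed

section \<open>Real and complex scalars\<close>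

locale scalar_structure =
  fixes J :: "'a::real_inner \<Rightarrow> 'a" and s :: real
  assumes J_linear: "linear J"
    and J_skew: "inner (J x) y = - inner x (J y)"
    and J_J: "J (J x) = - (s *\<^sub>R x)"
    and s_cases: "s = 0 \<or> s = 1"
begin

lemma inner_J_J: "inner (J x) (J y) = s * inner x y"
  by (simp add: J_skew J_J)

lemma inner_J_self [simp]: "inner (J x) x = 0" "inner x (J x) = 0"
proof -
  have "inner (J x) x = - inner (J x) x" by (metis J_skew inner_commute)
  then show "inner (J x) x = 0" by simp
  then show "inner x (J x) = 0" by (simp add: inner_commute)
qed

lemma inner_J_commute: "inner (J y) x = - inner (J x) y"
  by (metis J_skew inner_commute)

lemma J_eq_0: "s = 0 \<Longrightarrow> J x = 0"
  using inner_J_J[of x x] by simp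

lemmas J_simps = linear_add[OF J_linear] linear_diff[OF J_linear] linear_scale[OF J_linear]
  linear_0[OF J_linear] linear_neg[OF J_linear]

text \<open>The squared modulus of the scalar product; for unit vectors it is the transition
  probability of their rays. For \<open>s = 0\<close> the second term vanishes with
  \<open>J\<close>.\<close>

definition hsq :: "'a \<Rightarrow> 'a \<Rightarrow> real" where
  "hsq x y = (inner x y)\<^sup>2 + (inner (J x) y)\<^sup>2"

definition jperp :: "'a \<Rightarrow> 'a \<Rightarrow> bool" where
  "jperp x y \<longleftrightarrow> inner x y = 0 \<and> inner (J x) y = 0"

text \<open>The rank-one operator \<open>y \<mapsto> <u, y> u\<close> over the scalar field, written
  with real coefficients. It is a projection for unit \<open>u\<close>;
  \<open>op_trace_compress_line\<close> also uses it for vectors of other norms.\<close>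

definition line_proj :: "'a \<Rightarrow> 'a \<Rightarrow> 'a" where
  "line_proj u y = inner u y *\<^sub>R u + inner (J u) y *\<^sub>R J u"

definition jproj :: "('a \<Rightarrow> 'a) \<Rightarrow> bool" where
  "jproj P \<longleftrightarrow> orth_proj P \<and> finite_rank P \<and> (\<forall>x. P (J x) = J (P x))"

definition jorthonormal :: "'a set \<Rightarrow> bool" where
  "jorthonormal B \<longleftrightarrow> finite B \<and> pairwise jperp B \<and> (\<forall>b\<in>B. norm b = 1)"

definition span_proj :: "'a set \<Rightarrow> 'a \<Rightarrow> 'a" where
  "span_proj B y = (\<Sum>u\<in>B. line_proj u y)"

lemma jperp_commute: "jperp x y \<longleftrightarrow> jperp y x"
  by (simp add: jperp_def inner_commute[of y x] inner_J_commute[of y x])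

lemma hsq_commute: "hsq x y = hsq y x"
  by (simp add: hsq_def inner_commute[of y x] inner_J_commute[of y x])

lemma hsq_eq_0: "hsq x y = 0 \<longleftrightarrow> jperp x y"
  by (simp add: hsq_def jperp_def)

lemma hsq_self: "hsq x x = (norm x)^4"
  by (simp add: hsq_def power2_norm_eq_inner[symmetric])

section \<open>Projections onto scalar lines\<close>

lemma line_proj_linear: "linear (line_proj u)"
  by (rule linearI) (simp_all add: line_proj_def inner_add_right algebra_simps)

lemma line_proj_sa: "inner (line_proj u x) y = inner x (line_proj u y)"
  by (simp add: line_proj_def inner_add_left inner_add_right inner_commute)

lemma line_proj_J: "line_proj u (J y) = J (line_proj u y)"
  using s_cases
proof
  assume "s = 0"
  then show ?thesis by (simp add: line_proj_def J_eq_0)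
next
  assume s: "s = 1"
  have "inner u (J y) = - inner (J u) y" by (simp add: J_skew)
  then show ?thesis by (simp add: line_proj_def inner_J_J s J_simps J_J)
qed

lemma line_proj_self: "norm u = 1 \<Longrightarrow> line_proj u u = u"
  by (simp add: line_proj_def power2_norm_eq_inner[symmetric])

lemma line_proj_absorb:
  assumes "linear T" "\<And>x. T (J x) = J (T x)" "T u = u"
  shows "T (line_proj u x) = line_proj u x"
  using assms by (simp add: line_proj_def linear_add linear_scale)

lemma line_proj_annihilate:
  assumes "linear T" "\<And>x. T (J x) = J (T x)" "T u = 0"
  shows "T (line_proj u x) = 0"
  using assms by (simp add: line_proj_def linear_add linear_scale linear_0 J_linear)

lemma line_proj_idem: "norm u = 1 \<Longrightarrow> line_proj u (line_proj u x) = line_proj u x"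
  by (rule line_proj_absorb[OF line_proj_linear line_proj_J line_proj_self])

lemma line_proj_jperp: "jperp u v \<Longrightarrow> line_proj u v = 0"
  by (simp add: jperp_def line_proj_def)

lemma line_proj_jperp_comp: "jperp u v \<Longrightarrow> line_proj u (line_proj v x) = 0"
  by (rule line_proj_annihilate[OF line_proj_linear line_proj_J line_proj_jperp])

lemma range_line_proj: "range (line_proj u) \<subseteq> span {u, J u}"
  by (auto simp: line_proj_def intro!: span_add[OF span_scale[OF span_base] span_scale[OF span_base]])

lemma finite_rank_line_proj: "finite_rank (line_proj u)"
  unfolding finite_rank_def using range_line_proj[of u] by (intro exI[of _ "{u, J u}"]) auto

lemma jproj_line_proj: "norm u = 1 \<Longrightarrow> jproj (line_proj u)"
  by (simp add: jproj_def orth_proj_def line_proj_linear line_proj_idem line_proj_sa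
      finite_rank_line_proj line_proj_J)

lemma inner_line_proj: "inner y (line_proj u y) = hsq u y"
  by (simp add: line_proj_def hsq_def inner_add_right inner_commute power2_eq_square)

lemma norm_line_proj: "norm u = 1 \<Longrightarrow> (norm (line_proj u y))\<^sup>2 = hsq u y"
  using orth_proj_inner_self[of "line_proj u" y] jproj_line_proj[of u]
  by (simp add: inner_line_proj jproj_def)

text \<open>By Parseval, \<open>u\<close> and \<open>J u\<close> contribute their squared norms
  separately. The factor \<open>1 + s\<close> is the real dimension of the scalar field.\<close>

lemma op_trace_line_proj: "op_trace (line_proj u) = (1 + s) * (norm u)\<^sup>2"
proof -
  obtain C where C: "orthonormal C" "span C = span {u, J u}"
    using orthonormal_span_exists[of "{u, J u}"] by auto
  have u: "u \<in> span C" "J u \<in> span C" by (auto simp: C(2) span_base)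
  have "op_trace (line_proj u) = (\<Sum>c\<in>C. inner c (line_proj u c))"
    using range_line_proj[of u] by (intro op_trace_eq line_proj_sa C(1)) (simp add: C(2))
  also have "\<dots> = (\<Sum>c\<in>C. inner c u * inner c u) + (\<Sum>c\<in>C. inner c (J u) * inner c (J u))"
    by (simp add: inner_line_proj hsq_def sum.distrib power2_eq_square inner_commute)
  also have "\<dots> = inner u u + inner (J u) (J u)"
    using orthonormal_parseval[OF C(1) u(1), of u] orthonormal_parseval[OF C(1) u(2), of "J u"] by simp
  finally show ?thesis by (simp add: inner_J_J power2_norm_eq_inner algebra_simps)
qed

text \<open>Compressing the rank-one operator of \<open>x\<close> by \<open>N\<close> gives the
  rank-one operator of \<open>N x\<close>, so this trace records \<open>norm (N x)\<close>.\<close>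

lemma op_trace_compress_line:
  assumes "jproj N"
  shows "op_trace (N \<circ> line_proj x \<circ> N) = (1 + s) * (norm (N x))\<^sup>2"
proof -
  have "N \<circ> line_proj x \<circ> N = line_proj (N x)"
  proof
    fix y
    have "inner x (N y) = inner (N x) y" "inner (J x) (N y) = inner (J (N x)) y"
      using assms by (metis jproj_def orth_proj_sa)+
    then show "(N \<circ> line_proj x \<circ> N) y = line_proj (N x) y"
      using assms
      by (simp add: line_proj_def jproj_def linear_add[OF orth_proj_linear] linear_scale[OF orth_proj_linear])
  qed
  then show ?thesis by (simp add: op_trace_line_proj)
qed

text \<open>The line of \<open>u\<close> lies in the range of \<open>L\<close>, and equality of
  traces leaves no room for more.\<close>

lemma line_proj_eqI:
  assumes L: "jproj L" "op_trace L = 1 + s" and u: "norm u = 1" "L u = u"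
  shows "L = line_proj u"
proof (rule orth_proj_ext[symmetric])
  show "L (line_proj u x) = line_proj u x" for x
    using L(1) u(2) unfolding jproj_def by (intro line_proj_absorb orth_proj_linear) auto
qed (use L u jproj_line_proj[OF u(1)] in \<open>auto simp: jproj_def op_trace_line_proj\<close>)

lemma unit_in_range:
  assumes P: "orth_proj P" and x: "P x \<noteq> 0"
  obtains u where "norm u = 1" "P u = u" "\<And>T. linear T \<Longrightarrow> T (P x) = P x \<Longrightarrow> T u = u"
proof
  let ?u = "(1 / norm (P x)) *\<^sub>R P x"
  show "norm ?u = 1" using x by simp
  show "P ?u = ?u" using P by (simp add: linear_scale[OF orth_proj_linear] orth_proj_idem)
  show "T ?u = ?u" if "linear T" "T (P x) = P x" for T
    using that by (simp add: linear_scale)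
qed

lemma op_trace_0: "op_trace (\<lambda>x. 0) = 0"
  using op_trace_eq[of "\<lambda>x. 0" "{}"] by (auto simp: orthonormal_def)

lemma line_proj_ex:
  assumes L: "jproj L" "op_trace L = 1 + s"
  shows "\<exists>u. norm u = 1 \<and> L = line_proj u"
proof -
  have "op_trace L \<noteq> 0" using L(2) s_cases by auto
  then have "L \<noteq> (\<lambda>x. 0)" using op_trace_0 by metis
  then obtain x where "L x \<noteq> 0" by auto
  then obtain u where "norm u = 1" "L u = u"
    using unit_in_range[of L x] L(1) unfolding jproj_def by metis
  then show ?thesis using line_proj_eqI[OF L] by blast
qed

text \<open>A nonzero \<open>L (M x)\<close> lies in both ranges by commutation. Normalized, it
  spans both lines, so that \<open>L\<close> and \<open>M\<close> coincide.\<close>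

lemma line_proj_commuting:
  assumes L: "jproj L" "op_trace L = 1 + s" and M: "jproj M" "op_trace M = 1 + s"
    and c: "\<And>x. L (M x) = M (L x)" and ne: "L \<noteq> M"
  shows "L (M x) = 0"
proof (rule ccontr)
  assume "L (M x) \<noteq> 0"
  then have "M (L x) \<noteq> 0" "L (M (L x)) = M (L x)"
    using L(1) by (auto simp: c jproj_def orth_proj_idem)
  with M(1) unit_in_range[of M "L x"] L(1) obtain u where "norm u = 1" "M u = u" "L u = u"
    by (metis jproj_def orth_proj_linear)
  then show False using line_proj_eqI[OF L] line_proj_eqI[OF M] ne by metis
qed

section \<open>Projections spanned by orthonormal families\<close>

lemma span_proj_comp:
  assumes S: "jorthonormal (A \<union> B)"
  shows "span_proj A (span_proj B x) = span_proj (A \<inter> B) x"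
proof -
  have fin: "finite A" "finite B" using S by (auto simp: jorthonormal_def)
  have uv: "line_proj u (line_proj v x) = (if v = u then line_proj u x else 0)"
    if "u \<in> A" "v \<in> B" for u v
    using S that by (auto simp: jorthonormal_def pairwise_def line_proj_idem intro!: line_proj_jperp_comp)
  have "span_proj A (span_proj B x) = (\<Sum>u\<in>A. \<Sum>v\<in>B. line_proj u (line_proj v x))"
    by (simp add: span_proj_def linear_sum[OF line_proj_linear])
  also have "\<dots> = (\<Sum>u\<in>A. if u \<in> B then line_proj u x else 0)"
    using fin by (intro sum.cong refl) (simp add: uv cong: sum.cong)
  also have "\<dots> = (\<Sum>u\<in>A \<inter> B. line_proj u x)"
    using fin by (simp add: sum.inter_restrict)
  finally show ?thesis by (simp add: span_proj_def)
qed

lemma jproj_span_proj: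
  assumes "jorthonormal B"
  shows "jproj (span_proj B)"
proof -
  have fin: "finite B" using assms by (simp add: jorthonormal_def)
  have "finite_rank (span_proj B)"
    unfolding finite_rank_def
  proof (intro exI conjI subsetI)
    show "finite (B \<union> J ` B)" using fin by simp
    fix y assume "y \<in> range (span_proj B)"
    then obtain x where "y = (\<Sum>u\<in>B. line_proj u x)" by (auto simp: span_proj_def)
    then show "y \<in> span (B \<union> J ` B)"
      unfolding line_proj_def
      by (auto intro!: span_sum span_add[OF span_scale[OF span_base] span_scale[OF span_base]])
  qed
  moreover have "linear (span_proj B)"
    unfolding span_proj_def by (intro linear_compose_sum ballI line_proj_linear)
  ultimately show ?thesis
    using span_proj_comp[of B B] assms
    by (simp add: jproj_def orth_proj_def) (simp add: span_proj_def linear_sum[OF J_linear] line_proj_J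
      inner_sum_left inner_sum_right line_proj_sa)
qed

text \<open>Take a vector outside the real span of \<open>B\<close> and its image under
  \<open>J\<close>, and subtract its projection to that span. Including the image under
  \<open>J\<close> turns real orthogonality into orthogonality over the scalars.\<close>

lemma jperp_unit_exists:
  assumes inf: "\<And>B. finite B \<Longrightarrow> span B \<noteq> (UNIV :: 'a set)" and B: "finite B"
  shows "\<exists>v. norm v = 1 \<and> (\<forall>b\<in>B. jperp b v)"
proof -
  obtain C where C: "orthonormal C" "span C = span (B \<union> J ` B)"
    using orthonormal_span_exists[of "B \<union> J ` B"] B by auto
  obtain z where z: "z \<notin> span C" using inf[of "B \<union> J ` B"] B C by auto
  define w where "w = z - (\<Sum>c\<in>C. inner c z *\<^sub>R c)"
  have "w \<noteq> 0"
  proof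
    assume "w = 0"
    then have "z = (\<Sum>c\<in>C. inner c z *\<^sub>R c)" by (simp add: w_def)
    also have "\<dots> \<in> span C" by (intro span_sum span_scale span_base)
    finally show False using z by simp
  qed
  have Cw: "inner c w = 0" if "c \<in> C" for c
  proof -
    have "inner c (\<Sum>d\<in>C. inner d z *\<^sub>R d) = (\<Sum>d\<in>C. inner d z * inner c d)"
      by (simp add: inner_sum_right)
    also have "\<dots> = (\<Sum>d\<in>C. if c = d then inner d z else 0)"
      using that by (intro sum.cong) (auto simp: orthonormal_inner[OF C(1)])
    also have "\<dots> = inner c z" using that C(1) by (simp add: orthonormal_def)
    finally show ?thesis by (simp add: w_def inner_diff_right)
  qed
  have sw: "inner b w = 0" if "b \<in> span C" for b
    using that by (induction rule: span_induct_alt) (auto simp: inner_add_left Cw)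
  have "jperp b w" if "b \<in> B" for b
    using that sw[of b] sw[of "J b"] by (auto simp: jperp_def C(2) span_base)
  then show ?thesis
    using \<open>w \<noteq> 0\<close> by (intro exI[of _ "(1 / norm w) *\<^sub>R w"]) (auto simp: jperp_def)
qed

lemma jorthonormal_sequence:
  assumes inf: "\<And>B. finite B \<Longrightarrow> span B \<noteq> (UNIV :: 'a set)" and x: "norm x = 1"
  shows "\<exists>e :: nat \<Rightarrow> 'a. e 0 = x \<and> (\<forall>i. norm (e i) = 1) \<and> (\<forall>i j. i \<noteq> j \<longrightarrow> jperp (e i) (e j))"
proof -
  \<comment> \<open>\<open>Q f k r\<close> makes \<open>r\<close> an admissible term after
    \<open>f 0\<close>, ..., \<open>f (k - 1)\<close>; the last clause pins the start of the
    sequence to \<open>x\<close>.\<close>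
  define Q where "Q = (\<lambda>(f :: nat \<Rightarrow> 'a) k r. norm r = 1 \<and> (\<forall>i<k. jperp (f i) r) \<and> (k = 0 \<longrightarrow> r = x))"
  have "\<exists>f. \<forall>k. Q f k (f k)"
  proof (rule dependent_wellorder_choice)
    fix f k
    show "\<exists>r. Q f k r"
    proof (cases "k = 0")
      case False
      then show ?thesis using jperp_unit_exists[OF inf, of "f ` {..<k}"] by (auto simp: Q_def)
    qed (use x in \<open>auto simp: Q_def\<close>)
  qed (auto simp: Q_def)
  then obtain e where e: "\<And>k. Q e k (e k)" by auto
  have lt: "jperp (e i) (e j)" if "i < j" for i j using e[of j] that by (simp add: Q_def)
  have "jperp (e i) (e j)" if "i \<noteq> j" for i j
    using that lt[of i j] lt[of j i] by (metis jperp_commute linorder_neqE_nat)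
  then show ?thesis using e by (intro exI[of _ e]) (auto simp: Q_def)
qed

end

section \<open>From projections to rays\<close>

lemma tendsto_op_trace_compress:
  assumes P: "\<And>k. orth_proj (P k)" and L: "orth_proj L"
    and lim: "\<And>c. (\<lambda>k. (norm (P k c))\<^sup>2) \<longlonglongrightarrow> (norm (L c))\<^sup>2"
    and Q: "orth_proj Q" "finite_rank Q"
  shows "(\<lambda>k. op_trace (Q \<circ> P k \<circ> Q)) \<longlonglongrightarrow> op_trace (Q \<circ> L \<circ> Q)"
proof -
  obtain C where C: "orthonormal C" "range Q \<subseteq> span C" using finite_rank_orthonormal[OF Q(2)] .
  show ?thesis
    unfolding op_trace_compress[OF P Q(1) C] op_trace_compress[OF L Q(1) C]
    by (intro tendsto_sum lim)
qed

text \<open>The cross terms vanish because \<open>L (R k c) = 0\<close>, so Pythagoras leaves only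
  the norm of \<open>R k c\<close> to control, which tends to zero by Bessel.\<close>

lemma tendsto_norm_orthogonal_sum:
  assumes L: "orth_proj L" and R: "\<And>k. orth_proj (R k)" and LR: "\<And>k x. L (R k x) = 0"
    and orth: "\<And>k l x. k \<noteq> l \<Longrightarrow> R k (R l x) = 0"
  shows "(\<lambda>k::nat. (norm (L c + R k c))\<^sup>2) \<longlonglongrightarrow> (norm (L c))\<^sup>2"
proof -
  have "(norm (L c + R k c))\<^sup>2 = (norm (L c))\<^sup>2 + (norm (R k c))\<^sup>2" for k
  proof -
    have "inner (L c) (R k c) = 0" by (simp add: orth_proj_sa[OF L] LR)
    then show ?thesis
      by (simp add: power2_norm_eq_inner inner_add_left inner_add_right inner_commute)
  qed
  moreover have "(\<lambda>k. (norm (L c))\<^sup>2 + (norm (R k c))\<^sup>2) \<longlonglongrightarrow> (norm (L c))\<^sup>2 + 0"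
    by (intro tendsto_intros orthogonal_projections_tendsto_0 R orth)
  ultimately show ?thesis by simp
qed

context scalar_structure
begin

text \<open>Pigeonhole: the lines \<open>P 0 \<inter> P k\<close> are pairwise equal or orthogonal inside the finite-dimensional
  range of \<open>P 0\<close>, so infinitely many of them coincide.\<close>
lemma sunflower:
  fixes P :: "nat \<Rightarrow> 'a \<Rightarrow> 'a"
  assumes P: "\<And>k. jproj (P k)"
    and comm: "\<And>k l x. P k (P l x) = P l (P k x)"
    and tr: "\<And>k l. k \<noteq> l \<Longrightarrow> op_trace (P k \<circ> P l) = 1 + s"
  shows "\<exists>u r. norm u = 1 \<and> strict_mono r \<and> (\<forall>c. (\<lambda>k. (norm (P (r k) c))\<^sup>2) \<longlonglongrightarrow> (norm (line_proj u c))\<^sup>2)"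
proof -
  have op: "orth_proj (P k)" and fr: "finite_rank (P k)" and PJ: "P k (J x) = J (P k x)" for k x
    using P[of k] by (auto simp: jproj_def)
  have idem: "P k (P k x) = P k x" for k x by (rule orth_proj_idem[OF op])
  have PP: "jproj (P k \<circ> P l)" for k l
  proof -
    have "orth_proj (P k \<circ> P l)" by (rule orth_proj_comp[OF op op]) (rule comm)
    moreover have "finite_rank (P k \<circ> P l)" by (rule finite_rank_comp_left[OF fr])
    ultimately show ?thesis by (simp add: jproj_def PJ)
  qed
  \<comment> \<open>\<open>Suc\<close> keeps the second index different from 0, since
    \<open>tr\<close> speaks of distinct indices.\<close>
  define L where "L = (\<lambda>k. P 0 \<circ> P (Suc k))"
  have L: "jproj (L k)" "op_trace (L k) = 1 + s" for k
    using PP tr by (auto simp: L_def)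
  have Lcomm: "L k (L l x) = L l (L k x)" for k l x
    by (simp add: L_def) (metis comm)
  have "finite (range L)"
  proof (rule ccontr)
    \<comment> \<open>Infinitely many distinct lines would be pairwise orthogonal. All of them lie
      in the range of \<open>P 0\<close>, so by Bessel their traces would tend to zero, while each
      equals \<open>1 + s\<close>.\<close>
    assume "infinite (range L)"
    then obtain R :: "nat \<Rightarrow> 'a \<Rightarrow> 'a" where R: "inj R" "range R \<subseteq> range L"
      using infinite_countable_subset[of "range L"] by blast
    then have RL: "\<exists>l. R k = L l" for k by blast
    have jR: "jproj (R k)" and trR: "op_trace (R k) = 1 + s" for k using RL[of k] L by auto
    have Ro: "R k (R l x) = 0" if "k \<noteq> l" for k l x
    proof (rule line_proj_commuting[OF jR trR jR trR])
      show "R k \<noteq> R l" using R(1) that by (auto dest: injD)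
      show "R k (R l x) = R l (R k x)" for x using RL[of k] RL[of l] Lcomm by metis
    qed
    have oR: "orth_proj (R k)" for k using jR by (simp add: jproj_def)
    have "(\<lambda>k. op_trace (P 0 \<circ> R k \<circ> P 0)) \<longlonglongrightarrow> op_trace (P 0 \<circ> (\<lambda>x. 0) \<circ> P 0)"
      using orthogonal_projections_tendsto_0[OF oR Ro]
      by (intro tendsto_op_trace_compress oR op fr) (auto simp: orth_proj_def linear_zero)
    moreover have "P 0 \<circ> R k \<circ> P 0 = R k" for k
    proof -
      obtain l where "R k = L l" using RL by blast
      then show ?thesis by (auto simp: L_def fun_eq_iff) (metis comm idem)
    qed
    moreover have "P 0 \<circ> (\<lambda>x. 0) \<circ> P 0 = (\<lambda>x. 0)"
      by (auto simp: linear_0[OF orth_proj_linear[OF op]])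
    ultimately have "(\<lambda>k::nat. 1 + s) \<longlonglongrightarrow> 0" by (simp add: trR op_trace_0)
    then have "1 + s = 0" by (simp add: LIMSEQ_const_iff)
    then show False using s_cases by auto
  qed
  then obtain a where "infinite {k. L k = L a}"
    using pigeonhole_infinite[of "UNIV :: nat set" L] by auto
  then obtain r :: "nat \<Rightarrow> nat" where r: "strict_mono r" "\<And>k. L (r k) = L a"
    using infinite_enumerate[of "{k. L k = L a}"] by auto
  obtain u where u: "norm u = 1" "L a = line_proj u" using line_proj_ex[OF L] by blast
  define Q where "Q = (\<lambda>k. P (Suc (r k)))"
  have jQ: "jproj (Q k)" and oQ: "orth_proj (Q k)" for k using P op by (auto simp: Q_def)
  have Qu: "Q k u = u" for k
  proof -
    have "L (r k) u = u" using u r by (simp add: line_proj_self)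
    then have "P 0 (Q k u) = u" by (simp add: L_def Q_def)
    then have "Q k (P 0 u) = u" by (simp add: Q_def comm)
    then show ?thesis by (metis idem Q_def)
  qed
  \<comment> \<open>A product of two distinct members is a projection of trace \<open>1 + s\<close>
    that fixes \<open>u\<close>, hence the projection onto the line of \<open>u\<close>. So the
    parts of the \<open>Q k\<close> beyond this line are mutually orthogonal.\<close>
  have QQ: "Q k (Q l x) = line_proj u x" if "k \<noteq> l" for k l x
  proof -
    have "r k \<noteq> r l" using r(1) that by (metis strict_mono_eq)
    then have "Q k \<circ> Q l = line_proj u"
      unfolding Q_def by (intro line_proj_eqI u PP tr) (simp_all add: Qu[unfolded Q_def])
    then show ?thesis by (metis comp_apply)
  qed
  have ou: "orth_proj (line_proj u)" using jproj_line_proj[OF u(1)] by (simp add: jproj_def)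
  have Qabs: "Q k (line_proj u x) = line_proj u x" for k x
    using jQ[of k] by (intro line_proj_absorb[OF orth_proj_linear[OF oQ] _ Qu]) (simp add: jproj_def)
  have absQ: "line_proj u (Q k x) = line_proj u x" for k x
    by (rule orth_proj_absorb_right[OF ou oQ Qabs])
  have "(\<lambda>k. (norm (line_proj u c + (Q k c - line_proj u c)))\<^sup>2) \<longlonglongrightarrow> (norm (line_proj u c))\<^sup>2" for c
    by (intro tendsto_norm_orthogonal_sum ou orth_proj_diff oQ Qabs)
      (simp_all add: linear_diff[OF line_proj_linear] linear_diff[OF orth_proj_linear[OF oQ]]
        line_proj_idem[OF u(1)] absQ Qabs QQ)
  then show ?thesis
    using u(1) r(1) by (intro exI[of _ u] exI[of _ "\<lambda>k. Suc (r k)"]) (auto simp: Q_def strict_mono_def)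
qed

end

text \<open>\<open>PP\<close> stands for the set of rank-\<open>n\<close> projections over either
  field. Unitary equivalence enters only as orthogonal equivalence of the underlying real space,
  which suffices to compare traces and to transfer idempotency.\<close>

locale angle_preserver = scalar_structure J s for J :: "'a::real_inner \<Rightarrow> 'a" and s +
  fixes PP :: "('a \<Rightarrow> 'a) set" and \<phi> :: "('a \<Rightarrow> 'a) \<Rightarrow> 'a \<Rightarrow> 'a" and n :: nat
  assumes infinite_dim: "finite B \<Longrightarrow> span B \<noteq> (UNIV :: 'a set)"
    and n_pos: "0 < n"
    and PP_jproj: "P \<in> PP \<Longrightarrow> jproj P"
    and span_proj_PP: "jorthonormal B \<Longrightarrow> card B = n \<Longrightarrow> span_proj B \<in> PP"
    and \<phi>_PP: "P \<in> PP \<Longrightarrow> \<phi> P \<in> PP"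
    and angle: "P \<in> PP \<Longrightarrow> Q \<in> PP \<Longrightarrow> r_equiv (\<phi> Q \<circ> \<phi> P \<circ> \<phi> Q) (Q \<circ> P \<circ> Q)"
begin

lemma PP_orth_proj: "P \<in> PP \<Longrightarrow> orth_proj P" and PP_finite_rank: "P \<in> PP \<Longrightarrow> finite_rank P"
  using PP_jproj by (auto simp: jproj_def)

lemma op_trace_angle:
  assumes "P \<in> PP" "Q \<in> PP"
  shows "op_trace (\<phi> Q \<circ> \<phi> P \<circ> \<phi> Q) = op_trace (Q \<circ> P \<circ> Q)"
proof (rule op_trace_equiv[OF angle[OF assms]])
  show "finite_rank (\<phi> Q \<circ> \<phi> P \<circ> \<phi> Q)"
    unfolding comp_assoc by (intro finite_rank_comp_left PP_finite_rank \<phi>_PP assms)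
qed (simp_all add: orth_proj_sa[OF PP_orth_proj] \<phi>_PP assms)

text \<open>Angle preservation for \<open>P\<close> with itself, where the compression is
  \<open>P\<close>.\<close>

lemma op_trace_\<phi>: "P \<in> PP \<Longrightarrow> op_trace (\<phi> P) = op_trace P"
  using op_trace_angle[of P P]
  by (simp add: comp_def orth_proj_idem[OF PP_orth_proj] \<phi>_PP)

text \<open>The \<open>M k\<close> share the line of \<open>x\<close> and are orthogonal apart from
  it; \<open>u\<close> spans the common line of their images along a subsequence. The sequence is
  kept in the conclusion because further limits are taken along it.\<close>

lemma image_of_line:
  assumes x: "norm x = 1"
  shows "\<exists>u M. norm u = 1 \<and> (\<forall>k::nat. M k \<in> PP)
    \<and> (\<forall>c. (\<lambda>k. (norm (M k c))\<^sup>2) \<longlonglongrightarrow> (norm (line_proj x c))\<^sup>2)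
    \<and> (\<forall>c. (\<lambda>k. (norm (\<phi> (M k) c))\<^sup>2) \<longlonglongrightarrow> (norm (line_proj u c))\<^sup>2)"
proof -
  obtain e :: "nat \<Rightarrow> 'a" where e: "e 0 = x" "\<And>i. norm (e i) = 1" "\<And>i j. i \<noteq> j \<Longrightarrow> jperp (e i) (e j)"
    using jorthonormal_sequence[OF infinite_dim x] by blast
  have inj: "inj e"
  proof (rule injI, rule ccontr)
    fix i j assume "e i = e j" "i \<noteq> j"
    then have "inner (e i) (e i) = 0" using e(3)[of i j] by (simp add: jperp_def)
    then show False using e(2)[of i] by simp
  qed
  have jon: "jorthonormal (e ` A)" if "finite A" for A
    using that e by (auto simp: jorthonormal_def pairwise_def) (metis e(3))
  \<comment> \<open>Disjoint blocks of \<open>n - 1\<close> consecutive indices. Index 0 stays free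
    for \<open>x\<close>, so \<open>insert 0 (D k)\<close> has exactly \<open>n\<close>
    elements.\<close>
  define D where "D = (\<lambda>k. {k * (n - 1) <.. (k + 1) * (n - 1)})"
  have D: "finite (D k)" "0 \<notin> D k" "card (D k) = n - 1" for k by (auto simp: D_def)
  have DD: "D k \<inter> D l = {}" if "k \<noteq> l" for k l
  proof -
    have "D k \<inter> D l = {}" if "k < l" for k l
    proof -
      have "(k + 1) * (n - 1) \<le> l * (n - 1)" using that by (intro mult_right_mono) auto
      then show ?thesis by (auto simp: D_def)
    qed
    then show ?thesis using that by (metis inf_commute linorder_neqE_nat)
  qed
  define M where "M = (\<lambda>k. span_proj (e ` insert 0 (D k)))"
  have M: "M k \<in> PP" for k
    unfolding M_def
  proof (intro span_proj_PP jon)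
    have "card (e ` insert 0 (D k)) = card (insert 0 (D k))"
      by (intro card_image inj_on_subset[OF inj]) simp
    then show "card (e ` insert 0 (D k)) = n" using D n_pos by simp
  qed (simp add: D)
  have sp: "span_proj (e ` A) (span_proj (e ` B) y) = span_proj (e ` (A \<inter> B)) y"
    if "finite A" "finite B" for A B y
    using that jon[of "A \<union> B"] by (subst span_proj_comp) (auto simp: image_Un image_Int[OF inj])
  have x0: "span_proj (e ` {0}) = line_proj x" by (simp add: span_proj_def e(1) fun_eq_iff)
  have MM: "M k (M l y) = line_proj x y" if "k \<noteq> l" for k l y
    unfolding M_def using DD[OF that] D by (subst sp) (auto simp: x0[symmetric] simp del: image_insert)
  have Msum: "M k y = line_proj x y + span_proj (e ` D k) y" for k y
    using D[of k] by (simp add: M_def span_proj_def e(1)[symmetric] inj_image_mem_iff[OF inj])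
  have oD: "orth_proj (span_proj (e ` D k))" for k
    using jproj_span_proj[OF jon[OF D(1)]] by (simp add: jproj_def)
  have "(\<lambda>k. (norm (line_proj x c + span_proj (e ` D k) c))\<^sup>2) \<longlonglongrightarrow> (norm (line_proj x c))\<^sup>2" for c
  proof (rule tendsto_norm_orthogonal_sum[OF _ oD])
    show "orth_proj (line_proj x)" using jproj_line_proj[OF x] by (simp add: jproj_def)
    show "line_proj x (span_proj (e ` D k) y) = 0" for k y
      using D[of k] unfolding x0[symmetric] by (subst sp) (auto simp: span_proj_def)
    show "span_proj (e ` D k) (span_proj (e ` D l) y) = 0" if "k \<noteq> l" for k l y
      using D by (subst sp) (auto simp: DD[OF that] span_proj_def)
  qed
  then have limM: "(\<lambda>k. (norm (M k c))\<^sup>2) \<longlonglongrightarrow> (norm (line_proj x c))\<^sup>2" for c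
    by (simp add: Msum)

  define P where "P = (\<lambda>k. \<phi> (M k))"
  have P: "jproj (P k)" "orth_proj (P k)" for k
    using M by (auto simp: P_def intro!: PP_jproj PP_orth_proj \<phi>_PP)
  have MMM: "M k \<circ> M l \<circ> M k = line_proj x" if "k \<noteq> l" for k l
  proof
    fix y
    have "M k (M l (M k y)) = M k (M k (M l y))" using that by (simp add: MM)
    also have "\<dots> = line_proj x y" using that by (metis orth_proj_idem PP_orth_proj M MM)
    finally show "(M k \<circ> M l \<circ> M k) y = line_proj x y" by simp
  qed
  have comm: "P k (P l y) = P l (P k y)" for k l y
  proof (cases "k = l")
    case False
    \<comment> \<open>For distinct indices the compression of the \<open>M\<close>'s is the
      idempotent \<open>line_proj x\<close>. Hence the compression of their images is idempotent
      too, which forces the images to commute.\<close>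
    have "r_equiv (P l \<circ> P k \<circ> P l) (line_proj x)"
      using angle[OF M[of k] M[of l]] False by (simp add: P_def MMM)
    then have "(P l \<circ> P k \<circ> P l) ((P l \<circ> P k \<circ> P l) y) = (P l \<circ> P k \<circ> P l) y" for y
      by (rule equiv_idempotent) (rule line_proj_idem[OF x])
    then show ?thesis by (intro orth_proj_commute[OF P(2) P(2)]) simp
  qed simp
  have "op_trace (P k \<circ> P l) = 1 + s" if "k \<noteq> l" for k l
  proof -
    \<comment> \<open>Commutation turns the product into a compression, whose trace angle
      preservation determines.\<close>
    have "P k \<circ> P l = P k \<circ> P l \<circ> P k"
    proof
      fix y
      have "(P k \<circ> P l \<circ> P k) y = P k (P k (P l y))" by (simp add: comm[of l k])
      then show "(P k \<circ> P l) y = (P k \<circ> P l \<circ> P k) y" by (simp add: orth_proj_idem[OF P(2)])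
    qed
    then have "op_trace (P k \<circ> P l) = op_trace (M k \<circ> M l \<circ> M k)"
      using op_trace_angle[OF M M] by (metis P_def)
    then show ?thesis by (simp add: MMM[OF that] op_trace_line_proj x)
  qed
  then obtain u r where u: "norm u = 1"
    "\<And>c. (\<lambda>k. (norm (P (r k) c))\<^sup>2) \<longlonglongrightarrow> (norm (line_proj u c))\<^sup>2" "strict_mono r"
    using sunflower[of P, OF P(1) comm] by auto
  have "(\<lambda>k. (norm (M (r k) c))\<^sup>2) \<longlonglongrightarrow> (norm (line_proj x c))\<^sup>2" for c
    using LIMSEQ_subseq_LIMSEQ[OF limM u(3)] by (simp add: comp_def)
  then show ?thesis using u M by (intro exI[of _ u] exI[of _ "\<lambda>k. M (r k)"]) (auto simp: P_def)
qed

text \<open>\<open>g x\<close> is the vector \<open>u\<close> chosen for \<open>x\<close>. Comparing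
  \<open>N\<close> with the sequence of \<open>x\<close> and passing to the limit in the trace
  identity turns the two sides into multiples by \<open>1 + s\<close> of the squared norms of
  \<open>\<phi> N (g x)\<close> and \<open>N x\<close>.\<close>

lemma ray_map_exists:
  "\<exists>g. (\<forall>x. norm x = 1 \<longrightarrow> norm (g x) = 1)
    \<and> (\<forall>x y. norm x = 1 \<longrightarrow> norm y = 1 \<longrightarrow> hsq (g x) (g y) = hsq x y)
    \<and> (\<forall>x N. norm x = 1 \<longrightarrow> N \<in> PP \<longrightarrow> norm (\<phi> N (g x)) = norm (N x))"
proof -
  define good where "good = (\<lambda>x u M. norm u = 1 \<and> (\<forall>k::nat. M k \<in> PP)
    \<and> (\<forall>c. (\<lambda>k. (norm (M k c))\<^sup>2) \<longlonglongrightarrow> (norm (line_proj x c))\<^sup>2)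
    \<and> (\<forall>c. (\<lambda>k. (norm (\<phi> (M k) c))\<^sup>2) \<longlonglongrightarrow> (norm (line_proj u c))\<^sup>2))"
  have "\<exists>u M. good x u M" if "norm x = 1" for x
    using image_of_line[OF that] unfolding good_def .
  then obtain g M where good: "\<And>x. norm x = 1 \<Longrightarrow> good x (g x) (M x)" by metis
  have gM: "\<And>x. norm x = 1 \<Longrightarrow> norm (g x) = 1" "\<And>x k. norm x = 1 \<Longrightarrow> M x k \<in> PP"
    "\<And>x c. norm x = 1 \<Longrightarrow> (\<lambda>k. (norm (M x k c))\<^sup>2) \<longlonglongrightarrow> (norm (line_proj x c))\<^sup>2"
    "\<And>x c. norm x = 1 \<Longrightarrow> (\<lambda>k. (norm (\<phi> (M x k) c))\<^sup>2) \<longlonglongrightarrow> (norm (line_proj (g x) c))\<^sup>2"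
    using good unfolding good_def by blast+
  have N: "norm (\<phi> N (g x)) = norm (N x)" if x: "norm x = 1" and N: "N \<in> PP" for x N
  proof -
    have o: "orth_proj (line_proj x)" "orth_proj (line_proj (g x))"
      using jproj_line_proj x gM(1)[OF x] by (auto simp: jproj_def)
    have "(\<lambda>k. op_trace (N \<circ> M x k \<circ> N)) \<longlonglongrightarrow> op_trace (N \<circ> line_proj x \<circ> N)"
      using x N by (intro tendsto_op_trace_compress gM o PP_orth_proj PP_finite_rank)
    moreover have "(\<lambda>k. op_trace (\<phi> N \<circ> \<phi> (M x k) \<circ> \<phi> N)) \<longlonglongrightarrow> op_trace (\<phi> N \<circ> line_proj (g x) \<circ> \<phi> N)"
      using x N by (intro tendsto_op_trace_compress gM o PP_orth_proj PP_finite_rank \<phi>_PP)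
    moreover have "op_trace (\<phi> N \<circ> \<phi> (M x k) \<circ> \<phi> N) = op_trace (N \<circ> M x k \<circ> N)" for k
      using x N by (intro op_trace_angle gM)
    ultimately have "op_trace (\<phi> N \<circ> line_proj (g x) \<circ> \<phi> N) = op_trace (N \<circ> line_proj x \<circ> N)"
      using LIMSEQ_unique by fastforce
    then have "(1 + s) * (norm (\<phi> N (g x)))\<^sup>2 = (1 + s) * (norm (N x))\<^sup>2"
      using N by (simp add: op_trace_compress_line PP_jproj \<phi>_PP)
    then show ?thesis using s_cases by auto
  qed
  \<comment> \<open>Apply the norm identity at \<open>y\<close> with \<open>N = M x k\<close> and
    let \<open>k\<close> tend to infinity: both sides become norms of projections onto
    lines.\<close>
  have "hsq (g x) (g y) = hsq x y" if x: "norm x = 1" and y: "norm y = 1" for x y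
  proof -
    have "(\<lambda>k. (norm (\<phi> (M x k) (g y)))\<^sup>2) \<longlonglongrightarrow> (norm (line_proj (g x) (g y)))\<^sup>2"
      by (intro gM x)
    moreover have "(\<lambda>k. (norm (\<phi> (M x k) (g y)))\<^sup>2) \<longlonglongrightarrow> (norm (line_proj x y))\<^sup>2"
      using gM(3)[OF x, of y] by (simp add: N y gM(2)[OF x])
    ultimately have "(norm (line_proj (g x) (g y)))\<^sup>2 = (norm (line_proj x y))\<^sup>2"
      by (rule LIMSEQ_unique)
    then show ?thesis by (simp add: norm_line_proj x gM(1)[OF x])
  qed
  then show ?thesis using gM(1) N by blast
qed

end

section \<open>Wigner's theorem\<close>

context scalar_structure
begin

text \<open>The combination is \<open>w\<close> multiplied by the scalar with real part
  \<open>p\<close> and imaginary part \<open>q\<close>, so the squared modulus of that scalar comes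
  out. For \<open>s = 0\<close> the imaginary part has no effect, as \<open>J\<close>
  vanishes.\<close>

lemma hsq_combination: "hsq (p *\<^sub>R w + q *\<^sub>R J w) z = (p\<^sup>2 + s * q\<^sup>2) * hsq w z"
  using s_cases
proof
  assume "s = 0"
  then show ?thesis by (simp add: hsq_def J_eq_0 power_mult_distrib)
next
  assume "s = 1"
  then have J: "J (p *\<^sub>R w + q *\<^sub>R J w) = p *\<^sub>R J w - q *\<^sub>R w" by (simp add: J_simps J_J)
  show ?thesis
    unfolding hsq_def J inner_add_left inner_diff_left inner_scaleR_left \<open>s = 1\<close>
    by (simp add: power2_eq_square algebra_simps)
qed

lemma norm_combination: "(norm (p *\<^sub>R w + q *\<^sub>R J w))\<^sup>2 = (p\<^sup>2 + s * q\<^sup>2) * (norm w)\<^sup>2"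
  unfolding power2_norm_eq_inner
  by (simp add: inner_add_left inner_add_right inner_J_J power2_eq_square algebra_simps)

lemma hsq_scaleR: "hsq (a *\<^sub>R x) (b *\<^sub>R y) = a\<^sup>2 * b\<^sup>2 * hsq x y"
  by (simp add: hsq_def J_simps power2_eq_square algebra_simps)

lemma hsq_add_jperp: "jperp x a \<Longrightarrow> hsq x (a + b) = hsq x b"
  by (simp add: hsq_def jperp_def inner_add_right)

text \<open>The equality case of Cauchy-Schwarz: projecting \<open>z\<close> to the line of
  \<open>w\<close> loses no norm, so \<open>z\<close> equals its projection.\<close>

lemma hsq_eq_imp_combination:
  assumes eq: "hsq w z = (norm w)\<^sup>2 * (norm z)\<^sup>2" and w: "w \<noteq> 0"
  shows "z = (inner w z / (norm w)\<^sup>2) *\<^sub>R w + (inner (J w) z / (norm w)\<^sup>2) *\<^sub>R J w"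
proof -
  define u where "u = (1 / norm w) *\<^sub>R w"
  have u: "norm u = 1" using w by (simp add: u_def)
  have "hsq u z = (norm z)\<^sup>2"
    using hsq_scaleR[of "1 / norm w" w 1 z] w by (simp add: u_def eq power_divide)
  then have "norm (line_proj u z) = norm z" using norm_line_proj[OF u, of z] by simp
  then have "line_proj u z = z"
    using jproj_line_proj[OF u] orth_proj_fixes[of "line_proj u" z] by (simp add: jproj_def)
  then show ?thesis
    by (simp add: line_proj_def u_def J_simps power2_eq_square)
qed

text \<open>The left side is the squared modulus of \<open>1 + <y, z>\<close>; expanding it exposes
  the real part of \<open><y, z>\<close>.\<close>

lemma hsq_shift:
  assumes "norm e = 1" "jperp e y" "jperp e z"
  shows "hsq (e + y) (e + z) = 1 + 2 * inner y z + hsq y z"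
proof -
  have "inner e e = 1" using assms(1) by (simp add: power2_norm_eq_inner[symmetric])
  moreover have "inner y e = 0" "inner (J y) e = 0"
    using assms(2) jperp_commute[of e y] by (auto simp: jperp_def)
  ultimately show ?thesis
    using assms by (simp add: hsq_def jperp_def J_simps inner_add_left inner_add_right power2_eq_square algebra_simps)
qed

lemma jperp_subspace: "subspace {y. jperp e y}"
  by (auto simp: subspace_def jperp_def inner_add_right)

lemma jperp_J: "jperp e y \<Longrightarrow> jperp e (J y)"
  using J_skew[of e y] by (simp add: jperp_def inner_J_J)

lemma jperp_residual:
  assumes "norm e = 1" shows "jperp e (x - line_proj e x)"
proof -
  have ee: "inner e e = 1" using assms by (simp add: power2_norm_eq_inner[symmetric])
  have "s * inner (J e) x = inner (J e) x" using s_cases J_eq_0[of e] by auto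
  then show ?thesis
    by (simp add: jperp_def line_proj_def inner_diff_right inner_add_right inner_J_J ee algebra_simps)
qed

text \<open>Since \<open>g x\<close> and \<open>V x\<close> have the norm of \<open>x\<close>, the
  last conclusion is equality in Cauchy-Schwarz and puts \<open>V x\<close> on the scalar line of
  \<open>g x\<close>. The sign \<open>\<epsilon>\<close> separates linear from
  conjugate-linear.\<close>

lemma wigner:
  fixes g :: "'a \<Rightarrow> 'a" and e :: 'a
  assumes g: "\<And>x y. hsq (g x) (g y) = hsq x y" and e: "norm e = 1"
  shows "\<exists>V \<epsilon>. (\<epsilon> = 1 \<or> \<epsilon> = -1) \<and> linear V \<and> (\<forall>x. norm (V x) = norm x)
    \<and> (\<forall>x. V (J x) = \<epsilon> *\<^sub>R J (V x)) \<and> (\<forall>x. hsq (g x) (V x) = (norm x)^4)"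
proof -
  have ng: "norm (g x) = norm x" for x
    using g[of x x] by (simp add: hsq_self power_eq_iff_eq_base)
  have ee: "inner e e = 1" using e by (simp add: power2_norm_eq_inner[symmetric])
  define f where "f = g e"
  have nf: "norm f = 1" by (simp add: f_def ng e)
  have ff: "inner f f = 1" using nf by (simp add: power2_norm_eq_inner[symmetric])
  define E where "E = {y. jperp e y}"
  have subE: "subspace E" by (simp add: E_def jperp_subspace)
  have JE: "J y \<in> E" if "y \<in> E" for y using that by (simp add: E_def jperp_J)
  text \<open>\<open>v y\<close> is the representative of the ray of \<open>g (e + y)\<close> of the form \<open>f + T y\<close> with
    \<open>T y\<close> orthogonal to \<open>f\<close>.\<close>
  define v where "v = (\<lambda>y. inner f (g (e + y)) *\<^sub>R g (e + y) + (- inner (J f) (g (e + y))) *\<^sub>R J (g (e + y)))"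
  define T where "T = (\<lambda>y. v y - f)"
  have vT: "v y = f + T y" for y by (simp add: T_def)
  have
    v_hsq: "hsq (v y) z = hsq (g (e + y)) z" and
    v_norm: "(norm (v y))\<^sup>2 = (norm (e + y))\<^sup>2" and
    fT: "jperp f (T y)" if y: "y \<in> E" for y z
  proof -
    define w where "w = g (e + y)"
    define p where "p = inner f w"
    define q where "q = - inner (J f) w"
    have v: "v y = p *\<^sub>R w + q *\<^sub>R J w" by (simp add: v_def w_def p_def q_def)
    have "hsq f w = hsq e (e + y)" by (simp add: f_def w_def g)
    also have "\<dots> = 1" using y by (simp add: hsq_def E_def jperp_def inner_add_right ee)
    finally have pq: "p\<^sup>2 + q\<^sup>2 = 1" by (simp add: hsq_def p_def q_def)
    \<comment> \<open>For \<open>s = 0\<close> the operator \<open>J\<close> vanishes and with it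
      \<open>q\<close>, so both scalar fields share one computation.\<close>
    have sq: "s * q = q" using s_cases J_eq_0[of f] by (auto simp: q_def)
    then have "s * q\<^sup>2 = q\<^sup>2" by (metis mult.assoc power2_eq_square)
    with pq have spq: "p\<^sup>2 + s * q\<^sup>2 = 1" by linarith
    show "hsq (v y) z = hsq (g (e + y)) z" by (simp add: v hsq_combination spq flip: w_def)
    show "(norm (v y))\<^sup>2 = (norm (e + y))\<^sup>2"
      unfolding v norm_combination spq by (simp add: w_def ng)
    have "inner f (J w) = q" using J_skew[of f w] by (simp add: q_def)
    then have "inner f (v y) = 1" using pq by (simp add: v inner_add_right p_def power2_eq_square)
    moreover have "inner (J f) (v y) = 0"
    proof -
      have "inner (J f) (v y) = - (q * p) + (s * q) * p"
        unfolding v inner_add_right inner_scaleR_right inner_J_J by (simp add: p_def q_def)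
      then show ?thesis by (simp add: sq)
    qed
    ultimately show "jperp f (T y)" by (simp add: T_def jperp_def inner_diff_right ff)
  qed
  have gT: "hsq (g y) (T z) = hsq y z" if y: "y \<in> E" and z: "z \<in> E" for y z
  proof -
    \<comment> \<open>As \<open>g y\<close> is orthogonal to \<open>f\<close>, the vector
      \<open>T z\<close> may be replaced by \<open>v z\<close>, which lies on the line of
      \<open>g (e + z)\<close>.\<close>
    have "jperp f (g y)" using y unfolding f_def hsq_eq_0[symmetric] g by (simp add: hsq_eq_0 E_def)
    then have "hsq (g y) (T z) = hsq (g y) (v z)"
      by (simp add: vT hsq_add_jperp jperp_commute)
    also have "\<dots> = hsq (e + z) y" by (simp add: hsq_commute[of "g y"] v_hsq[OF z] g)
    also have "\<dots> = hsq y z"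
      using y by (simp add: hsq_commute[of "e + z"] E_def hsq_add_jperp jperp_commute)
    finally show ?thesis .
  qed
  have nT: "norm (T y) = norm y" if y: "y \<in> E" for y
  proof -
    have "(norm (f + T y))\<^sup>2 = (norm (e + y))\<^sup>2" using v_norm[OF y] by (simp add: vT)
    then have "(norm (T y))\<^sup>2 = (norm y)\<^sup>2"
      using fT[OF y] y by (simp add: power2_norm_eq_inner inner_add_left inner_add_right ee ff
          jperp_def E_def inner_commute)
    then show ?thesis by simp
  qed
  have hT: "hsq (T y) (T z) = hsq y z" if y: "y \<in> E" and z: "z \<in> E" for y z
  proof (cases "y = 0")
    case True
    then have "T y = 0" using nT[OF y] by simp
    then show ?thesis using True by (simp add: hsq_def J_simps)
  next
    case False
    \<comment> \<open>Coordinates of \<open>T y\<close> along \<open>g y\<close> and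
      \<open>J (g y)\<close>. Equality in Cauchy-Schwarz makes \<open>T y\<close> a multiple of
      \<open>g y\<close> by a scalar of modulus one.\<close>
    define a where "a = inner (g y) (T y) / (norm (g y))\<^sup>2"
    define b where "b = inner (J (g y)) (T y) / (norm (g y))\<^sup>2"
    have "hsq (g y) (T y) = (norm (g y))\<^sup>2 * (norm (T y))\<^sup>2"
      using y by (simp add: gT hsq_self ng nT power2_eq_square power4_eq_xxxx)
    moreover have "g y \<noteq> 0" using False ng[of y] by auto
    ultimately have Ty: "T y = a *\<^sub>R g y + b *\<^sub>R J (g y)"
      unfolding a_def b_def by (rule hsq_eq_imp_combination)
    have "(norm y)\<^sup>2 = (a\<^sup>2 + s * b\<^sup>2) * (norm y)\<^sup>2"
      using norm_combination[of a "g y" b] by (simp add: Ty[symmetric] nT[OF y] ng)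
    then have ab: "a\<^sup>2 + s * b\<^sup>2 = 1" using False by simp
    have "hsq (T y) (T z) = hsq (g y) (T z)"
      by (subst Ty) (simp add: hsq_combination ab)
    then show ?thesis by (simp add: gT[OF y z])
  qed
  have iT: "inner (T y) (T z) = inner y z" if y: "y \<in> E" and z: "z \<in> E" for y z
  proof -
    \<comment> \<open>\<open>T\<close> preserves the squared moduli of both
      \<open>1 + <y, z>\<close> and \<open><y, z>\<close>; the difference leaves the real
      part.\<close>
    have "hsq (v y) (v z) = hsq (e + z) (e + y)"
      by (metis v_hsq[OF y] v_hsq[OF z] hsq_commute g)
    also have "\<dots> = hsq (e + y) (e + z)" by (rule hsq_commute)
    also have "\<dots> = 1 + 2 * inner y z + hsq y z" using y z by (intro hsq_shift e) (auto simp: E_def)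
    finally have "1 + 2 * inner (T y) (T z) + hsq (T y) (T z) = 1 + 2 * inner y z + hsq y z"
      unfolding vT by (simp add: hsq_shift[OF nf fT[OF y] fT[OF z]])
    then show ?thesis by (simp add: hT[OF y z])
  qed
  note T_add = inner_preserving_linear_on(1)[OF subE iT]
    and T_scale = inner_preserving_linear_on(2)[OF subE iT]
  have T_J: "\<exists>c. (c = 1 \<or> c = -1) \<and> T (J y) = c *\<^sub>R J (T y)" if s: "s = 1" and y: "y \<in> E" for y
  proof (cases "y = 0")
    case True
    then have "T y = 0" using nT[OF y] by simp
    then show ?thesis using True by (auto simp: J_simps)
  next
    case False
    note Jy = JE[OF y]
    have nJ: "(norm (J z))\<^sup>2 = (norm z)\<^sup>2" for z by (simp add: power2_norm_eq_inner inner_J_J s)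
    \<comment> \<open>\<open>J y\<close> lies on the scalar line of \<open>y\<close>, hence
      \<open>T (J y)\<close> on that of \<open>T y\<close>. Its component along \<open>T y\<close>
      vanishes because \<open>y\<close> and \<open>J y\<close> are orthogonal, and comparing norms
      leaves only a sign.\<close>
    have "hsq (T y) (T (J y)) = hsq y (J y)" by (rule hT[OF y Jy])
    also have "\<dots> = (norm (T y))\<^sup>2 * (norm (T (J y)))\<^sup>2"
      unfolding nT[OF y] nT[OF Jy] nJ hsq_def inner_J_self inner_J_J s power2_norm_eq_inner
      by (simp add: power2_eq_square)
    finally have eq: "hsq (T y) (T (J y)) = (norm (T y))\<^sup>2 * (norm (T (J y)))\<^sup>2" .
    define c where "c = inner (J (T y)) (T (J y)) / (norm (T y))\<^sup>2"
    have "T y \<noteq> 0" using False nT[OF y] by auto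
    from hsq_eq_imp_combination[OF eq this] have c: "T (J y) = c *\<^sub>R J (T y)"
      by (simp add: c_def iT[OF y Jy])
    have "(norm (T (J y)))\<^sup>2 = c\<^sup>2 * (norm (J (T y)))\<^sup>2" by (simp add: c power_mult_distrib)
    then have "c\<^sup>2 = 1" using False by (simp add: nT[OF Jy] nT[OF y] nJ)
    then show ?thesis using c by (auto simp: power2_eq_1_iff)
  qed
  obtain \<epsilon> where \<epsilon>: "\<epsilon> = 1 \<or> \<epsilon> = -1" and T\<epsilon>: "\<And>y. y \<in> E \<Longrightarrow> T (J y) = \<epsilon> *\<^sub>R J (T y)"
  proof (cases "s = 1 \<and> (\<exists>y\<in>E. y \<noteq> 0)")
    case True
    then obtain y0 where s: "s = 1" and y0: "y0 \<in> E" "y0 \<noteq> 0" by auto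
    obtain c where c: "c = 1 \<or> c = -1" "T (J y0) = c *\<^sub>R J (T y0)" using T_J[OF s y0(1)] by blast
    have J0: "J z = 0 \<Longrightarrow> z = 0" for z using J_J[of z] s by (simp add: J_simps)
    have "T (J z) = c *\<^sub>R J (T z)" if z: "z \<in> E" for z
    proof (rule ccontr)
      \<comment> \<open>Opposite signs at \<open>y0\<close> and \<open>z\<close> clash with the sign
        \<open>k\<close> at their sum: it agrees with one of them, which makes \<open>J T\<close>
        vanish at the other.\<close>
      assume ne: "T (J z) \<noteq> c *\<^sub>R J (T z)"
      obtain d where d: "d = 1 \<or> d = -1" "T (J z) = d *\<^sub>R J (T z)" using T_J[OF s z] by blast
      have yz: "y0 + z \<in> E" using subE y0 z by (simp add: subspace_add)
      obtain k where k: "k = 1 \<or> k = -1" "T (J (y0 + z)) = k *\<^sub>R J (T (y0 + z))" using T_J[OF s yz] by blast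
      have "c *\<^sub>R J (T y0) + d *\<^sub>R J (T z) = k *\<^sub>R J (T y0) + k *\<^sub>R J (T z)"
        using k(2) by (simp add: J_simps T_add y0 z JE c(2) d(2) scaleR_add_right)
      then have "(c - k) *\<^sub>R J (T y0) = (k - d) *\<^sub>R J (T z)" by (simp add: algebra_simps)
      moreover have "d = - c" using c d ne by auto
      ultimately have "J (T y0) = 0 \<or> J (T z) = 0" using c(1) k(1) by auto
      then have "T y0 = 0 \<or> T z = 0" using J0 by blast
      then have "T z = 0" using nT[OF y0(1)] y0(2) by auto
      then show False using ne d(2) by (simp add: J_simps)
    qed
    then show ?thesis using that c(1) by blast
  next
    case False
    \<comment> \<open>Here \<open>J\<close> is zero or \<open>E\<close> is trivial, so both sides
      vanish and the sign 1 is a default.\<close>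
    have "T (J y) = 1 *\<^sub>R J (T y)" if "y \<in> E" for y
    proof -
      have "J y = 0 \<and> J (T y) = 0"
      proof (cases "s = 0")
        case False
        then have "y = 0" using \<open>\<not> (s = 1 \<and> (\<exists>y\<in>E. y \<noteq> 0))\<close> s_cases that by auto
        then show ?thesis using nT[OF that] by (simp add: J_simps)
      qed (simp add: J_eq_0)
      moreover have "T 0 = 0" using nT[of 0] subE by (simp add: subspace_0)
      ultimately show ?thesis by simp
    qed
    then show ?thesis using that by blast
  qed
  have \<epsilon>2: "\<epsilon> * \<epsilon> = 1" using \<epsilon> by auto
  \<comment> \<open>The coordinates of \<open>x\<close> along \<open>e\<close> and
    \<open>J e\<close> are carried to \<open>f\<close> and \<open>J f\<close>, with conjugation when
    \<open>\<epsilon> = -1\<close>; \<open>T\<close> acts on the remainder.\<close>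
  define V where "V = (\<lambda>x. inner e x *\<^sub>R f + (\<epsilon> * inner (J e) x) *\<^sub>R J f + T (x - line_proj e x))"
  have rE: "x - line_proj e x \<in> E" for x by (simp add: E_def jperp_residual e)
  have sJ: "s * inner (J e) x = inner (J e) x" for x using s_cases J_eq_0[of e] by auto
  have VV: "inner (V x) (V y) = inner x y" for x y
  proof -
    define x' y' where "x' = x - line_proj e x" and "y' = y - line_proj e y"
    have f': "inner f (T x') = 0" "inner (J f) (T x') = 0" "inner f (T y') = 0" "inner (J f) (T y') = 0"
      using fT[OF rE] by (auto simp: jperp_def x'_def y'_def)
    have "inner (V x) (V y) = inner e x * inner e y + (\<epsilon> * \<epsilon>) * inner (J e) x * (s * inner (J e) y) + inner x' y'"
      unfolding V_def x'_def[symmetric] y'_def[symmetric]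
      using iT[OF rE rE, of x y] f'
      by (simp add: inner_add_left inner_add_right ff inner_J_J inner_commute[of "T _" f]
          inner_commute[of "T _" "J f"] flip: x'_def y'_def)
    moreover have "inner x' y' = inner x y - inner e x * inner e y - inner (J e) x * inner (J e) y"
    proof -
      have "inner x' y' = inner x' y - inner x' (line_proj e y)"
        by (simp add: y'_def inner_diff_right)
      also have "inner x' (line_proj e y) = 0"
        using rE[of x] unfolding x'_def[symmetric]
        by (simp add: line_proj_def inner_add_right E_def jperp_def inner_commute[of x'])
      finally show ?thesis by (simp add: x'_def line_proj_def inner_diff_left inner_add_left)
    qed
    ultimately show ?thesis by (simp add: sJ \<epsilon>2)
  qed
  have "linear V"
    using inner_preserving_linear_on[of UNIV V] VV by (intro linearI) auto
  moreover have nV: "norm (V x) = norm x" for x by (simp add: norm_eq_sqrt_inner VV)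
  moreover have "V (J x) = \<epsilon> *\<^sub>R J (V x)" for x
  proof -
    have "J x - line_proj e (J x) = J (x - line_proj e x)" by (simp add: line_proj_J J_simps)
    then have "T (J x - line_proj e (J x)) = \<epsilon> *\<^sub>R J (T (x - line_proj e x))" by (simp add: T\<epsilon> rE)
    moreover have "inner e (J x) = - (s * inner (J e) x)" using J_skew[of e x] sJ[of x] by linarith
    moreover have "(\<epsilon> * (s * inner e x)) *\<^sub>R J f = (\<epsilon> * inner e x) *\<^sub>R J f"
      using s_cases J_eq_0[of f] by auto
    ultimately have "V (J x) = (- (s * inner (J e) x)) *\<^sub>R f + (\<epsilon> * inner e x) *\<^sub>R J f
        + \<epsilon> *\<^sub>R J (T (x - line_proj e x))"
      unfolding V_def inner_J_J by metis
    moreover have "\<epsilon> *\<^sub>R J (V x) = (- ((\<epsilon> * \<epsilon>) * (s * inner (J e) x))) *\<^sub>R f + (\<epsilon> * inner e x) *\<^sub>R J f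
        + \<epsilon> *\<^sub>R J (T (x - line_proj e x))"
      unfolding V_def by (simp only: J_simps J_J) (simp add: algebra_simps)
    ultimately show ?thesis by (simp add: \<epsilon>2)
  qed
  moreover have "hsq (g x) (V x) = (norm x)^4" for x
  proof -
    define a b y where "a = inner e x" and "b = inner (J e) x" and "y = x - line_proj e x"
    have y: "y \<in> E" by (simp add: y_def rE)
    have x: "x = a *\<^sub>R e + b *\<^sub>R J e + y" by (simp add: y_def a_def b_def line_proj_def)
    have Vx: "V x = a *\<^sub>R f + (\<epsilon> * b) *\<^sub>R J f + T y" by (simp add: V_def a_def b_def y_def)
    have sb: "s * b = b" by (simp add: b_def sJ)
    show ?thesis
    proof (cases "a = 0 \<and> b = 0")
      case True
      then have "V x = T x" "x \<in> E" using x Vx y by auto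
      then show ?thesis by (simp add: gT hsq_self)
    next
      case False
      define m where "m = a\<^sup>2 + s * b\<^sup>2"
      have m: "m = a\<^sup>2 + b\<^sup>2" using sb by (metis m_def mult.assoc power2_eq_square)
      have m0: "m \<noteq> 0" using False by (simp add: m)
      \<comment> \<open>\<open>z\<close> is \<open>y\<close> divided by the scalar with parts
        \<open>a\<close> and \<open>b\<close>, whose squared modulus is \<open>m\<close>. Then
        \<open>x\<close> is this scalar times \<open>e + z\<close>, and the claim reduces to
        \<open>v z\<close> and \<open>g (e + z)\<close>.\<close>
      define z where "z = (a / m) *\<^sub>R y + (- b / m) *\<^sub>R J y"
      have z: "z \<in> E" unfolding z_def using y JE[OF y] subE by (intro subspace_add subspace_scale)
      have yz: "y = a *\<^sub>R z + b *\<^sub>R J z"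
      proof -
        have "a *\<^sub>R z + b *\<^sub>R J z = ((a * a + b * (s * b)) / m) *\<^sub>R y"
          by (simp add: z_def J_simps J_J algebra_simps add_divide_distrib)
        moreover have "a * a + b * (s * b) = m" by (simp add: sb m power2_eq_square)
        ultimately show ?thesis using m0 by simp
      qed
      have xz: "x = a *\<^sub>R (e + z) + b *\<^sub>R J (e + z)"
        by (subst x, subst yz) (simp add: J_simps algebra_simps)
      have Ty: "T y = a *\<^sub>R T z + (b * \<epsilon>) *\<^sub>R J (T z)"
        using z subE by (subst yz) (simp add: T_add T_scale JE subspace_scale T\<epsilon>)
      have Vz: "V x = a *\<^sub>R v z + (\<epsilon> * b) *\<^sub>R J (v z)"
        unfolding Vx vT Ty by (simp add: J_simps algebra_simps)
      have "(\<epsilon> * b)\<^sup>2 = b\<^sup>2" using \<epsilon> by auto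
      then have "hsq (V x) (g x) = m * hsq (v z) (g x)"
        unfolding Vz hsq_combination by (simp add: m_def)
      also have "\<dots> = m * hsq (e + z) x" by (simp add: v_hsq[OF z] g)
      also have "hsq (e + z) x = hsq x (e + z)" by (rule hsq_commute)
      also have "\<dots> = m * hsq (e + z) (e + z)"
        by (subst xz) (simp add: hsq_combination m_def)
      finally have "hsq (V x) (g x) = (m * (norm (e + z))\<^sup>2)\<^sup>2"
        by (simp add: hsq_self power2_eq_square power4_eq_xxxx)
      also have "m * (norm (e + z))\<^sup>2 = (norm x)\<^sup>2"
        using norm_combination[of a "e + z" b] by (simp add: xz[symmetric] m_def)
      finally show ?thesis by (simp add: hsq_commute)
    qed
  qed
  ultimately show ?thesis using \<epsilon> by blast
qed

end

section \<open>Recovering the map on projections from the Wigner isometry\<close>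

context angle_preserver
begin

text \<open>\<open>\<phi> P\<close> loses no norm on \<open>g x\<close>, hence fixes it.
  \<open>V x\<close> lies on the scalar line of \<open>g x\<close>, which is fixed too because
  \<open>\<phi> P\<close> commutes with \<open>J\<close>.\<close>

lemma range_image_of_fixed:
  assumes "P \<in> PP" and x: "P x = x"
    and gx: "norm (g x) = norm x" "norm (\<phi> P (g x)) = norm (P x)"
    and V: "hsq (g x) (V x) = (norm x)^4" "norm (V x) = norm x"
  shows "\<phi> P (V x) = V x"
proof (cases "x = 0")
  case True
  then have "V x = 0" using V(2) by simp
  then show ?thesis using assms(1) by (simp add: linear_0[OF orth_proj_linear[OF PP_orth_proj[OF \<phi>_PP]]])
next
  case False
  note j = PP_jproj[OF \<phi>_PP[OF assms(1)], unfolded jproj_def]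
  define a b where "a = inner (g x) (V x) / (norm (g x))\<^sup>2"
    and "b = inner (J (g x)) (V x) / (norm (g x))\<^sup>2"
  have "\<phi> P (g x) = g x" using j gx x orth_proj_fixes[of "\<phi> P" "g x"] by simp
  moreover have "V x = a *\<^sub>R g x + b *\<^sub>R J (g x)"
    unfolding a_def b_def using V gx False
    by (intro hsq_eq_imp_combination) (auto simp: power2_eq_square power4_eq_xxxx)
  ultimately show ?thesis
    using j by (simp add: linear_add[OF orth_proj_linear] linear_scale[OF orth_proj_linear])
qed

end

text \<open>The adjoint \<open>W\<close> is a left inverse of the isometry \<open>V\<close>, so
  \<open>V P W\<close> is a projection. Its range lies in that of \<open>\<phi> P\<close>, and both
  have the trace of \<open>P\<close>.\<close>

lemma angle_preserver_is_conjugation: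
  fixes J :: "'a::{real_inner,complete_space} \<Rightarrow> 'a"
  assumes "angle_preserver J s PP \<phi> n"
  shows "\<exists>V W \<epsilon>. (\<epsilon> = 1 \<or> \<epsilon> = -1) \<and> linear V \<and> (\<forall>x. norm (V x) = norm x)
    \<and> (\<forall>x. V (J x) = \<epsilon> *\<^sub>R J (V x)) \<and> (\<forall>x y. inner (V x) y = inner x (W y))
    \<and> (\<forall>P\<in>PP. \<phi> P = V \<circ> P \<circ> W)"
proof -
  interpret angle_preserver J s PP \<phi> n by fact
  obtain g0 where g0: "\<And>x. norm x = 1 \<Longrightarrow> norm (g0 x) = 1"
    "\<And>x y. norm x = 1 \<Longrightarrow> norm y = 1 \<Longrightarrow> hsq (g0 x) (g0 y) = hsq x y"
    "\<And>x N. norm x = 1 \<Longrightarrow> N \<in> PP \<Longrightarrow> norm (\<phi> N (g0 x)) = norm (N x)"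
    using ray_map_exists by blast
  \<comment> \<open>Homogeneous extension from the unit sphere; the outer factor gives
    \<open>g 0 = 0\<close> whatever \<open>g0\<close> does at zero.\<close>
  define g where "g = (\<lambda>x. norm x *\<^sub>R g0 ((1 / norm x) *\<^sub>R x))"
  have unit: "norm ((1 / norm x) *\<^sub>R x) = 1" if "x \<noteq> 0" for x :: 'a using that by simp
  have ng: "norm (g x) = norm x" for x
    using g0(1)[OF unit] by (cases "x = 0") (auto simp: g_def)
  have hg: "hsq (g x) (g y) = hsq x y" for x y
  proof (cases "x = 0 \<or> y = 0")
    case True
    then show ?thesis using ng[of x] ng[of y] by (auto simp: hsq_def J_simps)
  next
    case False
    then have "hsq (g x) (g y) = (norm x)\<^sup>2 * (norm y)\<^sup>2 * hsq ((1 / norm x) *\<^sub>R x) ((1 / norm y) *\<^sub>R y)"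
      unfolding g_def hsq_scaleR[of "norm x"] using g0(2)[OF unit unit, of x y] by simp
    then show ?thesis unfolding hsq_scaleR using False by (simp add: power_divide)
  qed
  have Ng: "norm (\<phi> N (g x)) = norm (N x)" if N: "N \<in> PP" for N x
  proof (cases "x = 0")
    case True
    then have "g x = 0" using ng[of x] by simp
    then show ?thesis
      using True N by (simp add: linear_0[OF orth_proj_linear[OF PP_orth_proj]] \<phi>_PP)
  next
    case False
    have "norm (\<phi> N (g x)) = norm x * norm (\<phi> N (g0 ((1 / norm x) *\<^sub>R x)))"
      using N by (simp add: g_def linear_scale[OF orth_proj_linear[OF PP_orth_proj]] \<phi>_PP)
    also have "\<dots> = norm x * norm (N ((1 / norm x) *\<^sub>R x))" using g0(3)[OF unit[OF False] N] by simp
    also have "\<dots> = norm (N x)"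
      using N False by (simp add: linear_scale[OF orth_proj_linear[OF PP_orth_proj]])
    finally show ?thesis .
  qed
  obtain e :: 'a where "norm e = 1" using jperp_unit_exists[OF infinite_dim, of "{}"] by auto
  from wigner[OF hg this] obtain V \<epsilon> where V: "\<epsilon> = 1 \<or> \<epsilon> = -1" "linear V" "\<And>x. norm (V x) = norm x"
    "\<And>x. V (J x) = \<epsilon> *\<^sub>R J (V x)" "\<And>x. hsq (g x) (V x) = (norm x)^4" by blast
  obtain W where W: "\<And>x y. inner (V x) y = inner x (W y)" using isometry_adjoint_exists[OF V(2,3)] by blast
  have W': "inner y (V x) = inner (W y) x" for x y using W[of x y] by (simp add: inner_commute)
  note VV = orthogonal_map_inner[OF V(2,3)]
  have WV: "W (V y) = y" for y
  proof -
    have "inner x (W (V y) - y) = 0" for x by (simp add: inner_diff_right W[symmetric] VV)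
    then show ?thesis by (metis eq_iff_diff_eq_0 inner_eq_zero_iff)
  qed
  have "linear W"
  proof (rule linearI)
    fix x y c
    have "inner z (W (x + y) - (W x + W y)) = 0" "inner z (W (c *\<^sub>R x) - c *\<^sub>R W x) = 0" for z
      by (simp_all add: inner_diff_right inner_add_right W[symmetric])
    then show "W (x + y) = W x + W y" "W (c *\<^sub>R x) = c *\<^sub>R W x"
      by (metis eq_iff_diff_eq_0 inner_eq_zero_iff)+
  qed
  have "\<phi> P = V \<circ> P \<circ> W" if P: "P \<in> PP" for P
  proof -
    note oP = PP_orth_proj[OF P]
    have sa: "inner ((V \<circ> P \<circ> W) x) y = inner x ((V \<circ> P \<circ> W) y)" for x y
      by (simp add: W W' orth_proj_sa[OF oP])
    have "V \<circ> P \<circ> W = \<phi> P"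
    proof (rule orth_proj_ext)
      show "orth_proj (V \<circ> P \<circ> W)"
        unfolding orth_proj_def
        using linear_compose[OF linear_compose[OF \<open>linear W\<close> orth_proj_linear[OF oP]] V(2)] sa
        by (auto simp: WV orth_proj_idem[OF oP] comp_assoc)
      show "orth_proj (\<phi> P)" "finite_rank (\<phi> P)"
        using P by (auto intro: PP_orth_proj PP_finite_rank \<phi>_PP)
      obtain B where B: "finite B" "range P \<subseteq> span B"
        using PP_finite_rank[OF P] by (auto simp: finite_rank_def)
      then have "range (V \<circ> P \<circ> W) \<subseteq> span (V ` B)" by (auto simp: linear_span_image[OF V(2)])
      then show "finite_rank (V \<circ> P \<circ> W)"
        unfolding finite_rank_def using B(1) by blast
      have "op_trace P = op_trace (V \<circ> P \<circ> W)"
        using orth_proj_sa[OF oP] PP_finite_rank[OF P] sa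
        by (intro op_trace_isometry[OF V(2,3)]) (auto simp: WV)
      then show "op_trace (V \<circ> P \<circ> W) = op_trace (\<phi> P)" by (simp add: op_trace_\<phi> P)
      show "\<phi> P ((V \<circ> P \<circ> W) x) = (V \<circ> P \<circ> W) x" for x
        using range_image_of_fixed[where g = g and V = V and x = "P (W x)", OF P orth_proj_idem[OF oP] ng Ng[OF P] V(5) V(3)] by simp
    qed
    then show ?thesis by simp
  qed
  then show ?thesis using V W by blast
qed

section \<open>The real and the complex case\<close>

lemma orth_proj_bounded_linear:
  assumes "orth_proj P" shows "bounded_linear P"
proof (rule bounded_linear_intro[of _ 1])
  show "norm (P x) \<le> norm x * 1" for x using orth_proj_norm_le[OF assms] by simp
qed (simp_all add: linear_add[OF orth_proj_linear[OF assms]] linear_scale[OF orth_proj_linear[OF assms]])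

lemma (in scalar_structure) span_proj_fixes:
  assumes B: "jorthonormal B" and b: "b \<in> B"
  shows "span_proj B b = b"
proof -
  have "line_proj u b = (if u = b then b else 0)" if "u \<in> B" for u
    using B b that
    by (auto simp: jorthonormal_def pairwise_def line_proj_self intro!: line_proj_jperp)
  then have "span_proj B b = (\<Sum>u\<in>B. if u = b then b else 0)" by (simp add: span_proj_def)
  also have "\<dots> = b" using B b by (simp add: jorthonormal_def)
  finally show ?thesis .
qed

section \<open>Real scalars\<close>

lemma scalar_structure_real: "scalar_structure (\<lambda>x. 0 :: 'a::real_inner) 0"
  by unfold_locales (auto simp: linear_zero)

lemma r_Proj_orth_proj:
  assumes "P \<in> r_Proj n" shows "orth_proj P" "finite_rank P"
proof -
  have "bounded_linear P" "\<And>x. P (P x) = P x" "\<And>x y. inner (P x) y = inner x (P y)"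
    using assms by (auto simp: r_Proj_def r_projection_def fun_eq_iff)
  then show "orth_proj P" by (simp add: orth_proj_def bounded_linear.linear)
  obtain B where "finite B" "span B = range P" using assms by (auto simp: r_Proj_def r_rank_eq_def)
  then show "finite_rank P" by (metis finite_rank_def order_refl)
qed

lemma span_proj_in_r_Proj:
  fixes B :: "'a::real_inner set"
  assumes B: "scalar_structure.jorthonormal (\<lambda>x. 0) B"
  shows "scalar_structure.span_proj (\<lambda>x. 0) B \<in> r_Proj (card B)"
proof -
  interpret scalar_structure "\<lambda>x. 0 :: 'a" 0 by (rule scalar_structure_real)
  have fin: "finite B" using B by (simp add: jorthonormal_def)
  have o: "orth_proj (span_proj B)" using jproj_span_proj[OF B] by (simp add: jproj_def)
  have "r_projection (span_proj B)"
    using o orth_proj_bounded_linear[OF o] by (auto simp: r_projection_def orth_proj_def)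
  moreover have "r_rank_eq (span_proj B) (card B)"
    unfolding r_rank_eq_def
  proof (intro exI[of _ B] conjI fin refl)
    have "pairwise orthogonal B" "0 \<notin> B"
      using B by (auto simp: jorthonormal_def jperp_def pairwise_def orthogonal_def)
    then show "independent B" by (intro pairwise_orthogonal_independent)
    show "span B = range (span_proj B)"
    proof
      have "span_proj B x = x" if "x \<in> span B" for x
        using linear_eq_on_span[OF orth_proj_linear[OF o] linear_id, of B x] span_proj_fixes[OF B] that
        by simp
      then show "span B \<subseteq> range (span_proj B)" by (metis rangeI subsetI)
      show "range (span_proj B) \<subseteq> span B"
        by (auto simp: span_proj_def line_proj_def intro!: span_sum span_scale[OF span_base])
    qed
  qed
  ultimately show ?thesis by (simp add: r_Proj_def)
qed

section \<open>Complex scalars\<close>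

lemma scaleC_eq: "a *\<^sub>C x = Re a *\<^sub>R x + Im a *\<^sub>R (\<i> *\<^sub>C x)"
proof -
  have "a = complex_of_real (Re a) + complex_of_real (Im a) * \<i>" by (simp add: complex_eq_iff)
  from arg_cong[OF this, of "\<lambda>c. c *\<^sub>C x"] show ?thesis by (simp add: scaleC_add_left scaleR_scaleC scaleC_scaleC)
qed

lemma cinner_scaleC_left: "cinner (a *\<^sub>C x) y = cnj a * cinner x y"
  by (simp add: cinner_commute[of "a *\<^sub>C x" y] cinner_commute[of x y] cinner_scaleC_right)

lemma cinner_eq: "cinner x y = Complex (inner x y) (inner (\<i> *\<^sub>C x) y)"
  by (simp add: complex_eq_iff inner_is_Re_cinner cinner_scaleC_left)

lemma scaleC_linear: "linear (\<lambda>x :: 'a::complex_inner. a *\<^sub>C x)"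
  by (rule linearI) (simp_all add: scaleC_add_right scaleR_scaleC scaleC_scaleC mult.commute)

lemma scalar_structure_complex: "scalar_structure (\<lambda>x :: 'a::complex_inner. \<i> *\<^sub>C x) 1"
proof (rule scalar_structure.intro)
  fix x y :: 'a
  show "inner (\<i> *\<^sub>C x) y = - inner x (\<i> *\<^sub>C y)"
    by (simp add: inner_is_Re_cinner cinner_scaleC_left cinner_scaleC_right)
  show "\<i> *\<^sub>C \<i> *\<^sub>C x = - (1 *\<^sub>R x)"
    using scaleC_eq[of "-1" x] by (simp add: scaleC_scaleC)
qed (simp_all add: scaleC_linear)

lemma c_linear_iff: "c_linear T \<longleftrightarrow> linear T \<and> (\<forall>x. T (\<i> *\<^sub>C x) = \<i> *\<^sub>C T x)"
proof
  assume "c_linear T"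
  then show "linear T \<and> (\<forall>x. T (\<i> *\<^sub>C x) = \<i> *\<^sub>C T x)"
    by (auto simp: c_linear_def scaleR_scaleC intro!: linearI)
next
  assume T: "linear T \<and> (\<forall>x. T (\<i> *\<^sub>C x) = \<i> *\<^sub>C T x)"
  then have "T (a *\<^sub>C x) = a *\<^sub>C T x" for a x
    by (simp add: scaleC_eq[of a] linear_add linear_scale)
  then show "c_linear T" using T by (simp add: c_linear_def linear_add)
qed

lemma c_antilinearI:
  assumes "linear T" "\<And>x. T (\<i> *\<^sub>C x) = - (\<i> *\<^sub>C T x)"
  shows "c_antilinear T"
proof -
  have "T (a *\<^sub>C x) = cnj a *\<^sub>C T x" for a x
    unfolding scaleC_eq[of a x] scaleC_eq[of "cnj a" "T x"] using assms
    by (simp add: linear_add linear_scale)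
  then show ?thesis using assms by (simp add: c_antilinear_def linear_add)
qed

lemma c_span_subset_span:
  "c_span B \<subseteq> span (B \<union> (\<lambda>x. \<i> *\<^sub>C x) ` B)"
proof
  fix x assume "x \<in> c_span B"
  then obtain S c where S: "S \<subseteq> B" "x = (\<Sum>b\<in>S. c b *\<^sub>C b)" by (auto simp: c_span_def)
  have "Re (c b) *\<^sub>R b + Im (c b) *\<^sub>R (\<i> *\<^sub>C b) \<in> span (B \<union> (\<lambda>x. \<i> *\<^sub>C x) ` B)" if "b \<in> S" for b
    using S(1) that by (intro span_add span_scale span_base) auto
  then show "x \<in> span (B \<union> (\<lambda>x. \<i> *\<^sub>C x) ` B)"
    unfolding S(2) scaleC_eq[of "c _"] by (intro span_sum)
qed

text \<open>A finite set spanning over the reals also spans over the complex numbers.\<close>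

lemma c_infinite_dim_real:
  assumes "c_infinite_dim TYPE('a::complex_inner)" "finite B"
  shows "span B \<noteq> (UNIV :: 'a set)"
proof
  assume "span B = UNIV"
  then have "x \<in> c_span B" for x
  proof -
    have "x \<in> range (\<lambda>u. \<Sum>v\<in>B. u v *\<^sub>R v)" using \<open>span B = UNIV\<close> span_finite[OF assms(2)] by auto
    then obtain u where "x = (\<Sum>v\<in>B. u v *\<^sub>R v)" by blast
    then have "x = (\<Sum>v\<in>B. complex_of_real (u v) *\<^sub>C v)" by (simp only: scaleR_scaleC)
    then show ?thesis
      unfolding c_span_def using assms(2)
      by (intro CollectI exI[of _ B] exI[of _ "\<lambda>v. complex_of_real (u v)"]) simp
  qed
  then have "c_span B = UNIV" by blast
  then show False using assms unfolding c_infinite_dim_def by blast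
qed

lemma c_Proj_orth_proj:
  assumes "P \<in> c_Proj n"
  shows "orth_proj P" "finite_rank P" "P (\<i> *\<^sub>C x) = \<i> *\<^sub>C P x"
proof -
  have P: "linear P" "\<And>x. P (\<i> *\<^sub>C x) = \<i> *\<^sub>C P x" "\<And>x. P (P x) = P x"
      "\<And>x y. cinner (P x) y = cinner x (P y)"
    using assms by (auto simp: c_Proj_def c_projection_def c_linear_iff fun_eq_iff)
  then show "orth_proj P" "P (\<i> *\<^sub>C x) = \<i> *\<^sub>C P x"
    by (auto simp: orth_proj_def inner_is_Re_cinner)
  obtain B where "finite B" "c_span B = range P"
    using assms by (auto simp: c_Proj_def c_rank_eq_def)
  then show "finite_rank P"
    using c_span_subset_span[of B] unfolding finite_rank_def
    by (intro exI[of _ "B \<union> (\<lambda>x. \<i> *\<^sub>C x) ` B"]) auto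
qed

text \<open>The two real conditions in \<open>jperp\<close> are the real and imaginary parts of
  \<open>cinner\<close>, so \<open>B\<close> is complex orthonormal and itself serves as basis of
  the range.\<close>

lemma span_proj_in_c_Proj:
  fixes B :: "'a::complex_inner set"
  assumes B: "scalar_structure.jorthonormal (\<lambda>x. \<i> *\<^sub>C x) B"
  shows "scalar_structure.span_proj (\<lambda>x. \<i> *\<^sub>C x) B \<in> c_Proj (card B)"
proof -
  interpret scalar_structure "\<lambda>x :: 'a. \<i> *\<^sub>C x" 1 by (rule scalar_structure_complex)
  have fin: "finite B" using B by (simp add: jorthonormal_def)
  have cB: "cinner b b' = (if b = b' then 1 else 0)" if "b \<in> B" "b' \<in> B" for b b'
    using B that
    by (auto simp: cinner_eq jorthonormal_def pairwise_def jperp_def complex_eq_iff power2_norm_eq_inner[symmetric])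
  have lin: "c_linear (span_proj B)" and o: "orth_proj (span_proj B)"
    using jproj_span_proj[OF B] by (auto simp: c_linear_iff jproj_def orth_proj_linear)
  have sum_lin: "span_proj B (\<Sum>b\<in>S. c b *\<^sub>C b) = (\<Sum>b\<in>S. c b *\<^sub>C span_proj B b)" for S c
    using lin by (simp add: linear_sum[OF orth_proj_linear[OF o]] c_linear_def)
  have "cinner (span_proj B x) y = cinner x (span_proj B y)" for x y
    using lin orth_proj_sa[OF o] unfolding cinner_eq c_linear_iff by metis
  moreover have "c_bounded (span_proj B)"
    unfolding c_bounded_def using orth_proj_norm_le[OF o] by (intro exI[of _ 1]) simp
  ultimately have "c_projection (span_proj B)"
    using lin o by (auto simp: c_projection_def orth_proj_idem)
  moreover have "c_rank_eq (span_proj B) (card B)"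
    unfolding c_rank_eq_def
  proof (intro exI[of _ B] conjI fin refl)
    show "c_independent B"
      unfolding c_independent_def
    proof (intro allI impI ballI, elim conjE)
      fix S c b assume S: "finite S" "S \<subseteq> B" "(\<Sum>b\<in>S. c b *\<^sub>C b) = 0" and b: "b \<in> S"
      have c0: "cinner b 0 = 0" using cinner_scaleC_right[of b 0 b] by (simp add: scaleC_eq[of 0 b])
      have "cinner b (\<Sum>d\<in>T. c d *\<^sub>C d) = (\<Sum>d\<in>T. c d * cinner b d)" for T
        by (induction T rule: infinite_finite_induct) (auto simp: c0 cinner_add_right cinner_scaleC_right)
      then have "0 = (\<Sum>d\<in>S. c d * cinner b d)" using S(3) c0 by metis
      also have "\<dots> = (\<Sum>d\<in>S. if d = b then c b else 0)"
        using S(2) b by (intro sum.cong) (auto simp: cB subset_iff)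
      finally show "c b = 0" using S(1) b by simp
    qed
    show "c_span B = range (span_proj B)"
    proof
      have "span_proj B x = x" if x: "x \<in> c_span B" for x
      proof -
        obtain S c where S: "S \<subseteq> B" "x = (\<Sum>b\<in>S. c b *\<^sub>C b)" using x unfolding c_span_def by blast
        have "span_proj B x = (\<Sum>b\<in>S. c b *\<^sub>C span_proj B b)" by (simp add: S(2) sum_lin)
        also have "\<dots> = x" unfolding S(2) using S(1) by (intro sum.cong) (auto simp: span_proj_fixes[OF B])
        finally show ?thesis .
      qed
      then show "c_span B \<subseteq> range (span_proj B)" by (metis rangeI subsetI)
      \<comment> \<open>The complex form of \<open>line_proj b x\<close> is
        \<open>cinner b x *\<^sub>C b\<close>.\<close>
      have "span_proj B x = (\<Sum>b\<in>B. cinner b x *\<^sub>C b)" for x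
        by (simp add: span_proj_def line_proj_def scaleC_eq[of "Complex _ _"] cinner_eq)
      then show "range (span_proj B) \<subseteq> c_span B" using fin by (auto simp: c_span_def)
    qed
  qed
  ultimately show ?thesis by (simp add: c_Proj_def)
qed

lemma c_equiv_imp_r_equiv: "c_equiv A B \<Longrightarrow> r_equiv A B"
  unfolding c_equiv_def r_equiv_def c_unitary_def r_orthogonal_def c_linear_iff by blast

theorem theorem2:
  shows "(\<forall>(\<phi> :: ('a::{real_inner,complete_space} \<Rightarrow> 'a) \<Rightarrow> ('a \<Rightarrow> 'a)) (n::nat).
            r_infinite_dim TYPE('a) \<and> 1 < n
          \<and> (\<forall>P \<in> r_Proj n. \<phi> P \<in> r_Proj n)
          \<and> (\<forall>P \<in> r_Proj n. \<forall>Q \<in> r_Proj n. r_angle_eq (\<phi> P) (\<phi> Q) P Q)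
          \<longrightarrow> (\<exists>V W. linear V \<and> (\<forall>x. norm (V x) = norm x)
                  \<and> (\<forall>x y. inner (V x) y = inner x (W y))
                  \<and> (\<forall>P \<in> r_Proj n. \<phi> P = V \<circ> P \<circ> W)))
       \<and> (\<forall>(\<psi> :: ('b::{complex_inner,complete_space} \<Rightarrow> 'b) \<Rightarrow> ('b \<Rightarrow> 'b)) (n::nat).
            c_infinite_dim TYPE('b) \<and> 1 < n
          \<and> (\<forall>P \<in> c_Proj n. \<psi> P \<in> c_Proj n)
          \<and> (\<forall>P \<in> c_Proj n. \<forall>Q \<in> c_Proj n. c_angle_eq (\<psi> P) (\<psi> Q) P Q)
          \<longrightarrow> (\<exists>V W. (\<forall>x. norm (V x) = norm x)
                  \<and> ((c_linear V \<and> (\<forall>x y. cinner (V x) y = cinner x (W y)))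
                     \<or> (c_antilinear V \<and> (\<forall>x y. cinner (V x) y = cnj (cinner x (W y)))))
                  \<and> (\<forall>P \<in> c_Proj n. \<psi> P = V \<circ> P \<circ> W)))"
proof (intro conjI allI impI; elim conjE)
  fix \<phi> :: "('a \<Rightarrow> 'a) \<Rightarrow> ('a \<Rightarrow> 'a)" and n :: nat
  assume inf: "r_infinite_dim TYPE('a)" and n: "1 < n" and \<phi>: "\<forall>P\<in>r_Proj n. \<phi> P \<in> r_Proj n"
    and angle: "\<forall>P\<in>r_Proj n. \<forall>Q\<in>r_Proj n. r_angle_eq (\<phi> P) (\<phi> Q) P Q"
  interpret scalar_structure "\<lambda>x. 0 :: 'a" 0 by (rule scalar_structure_real)
  have "angle_preserver (\<lambda>x. 0 :: 'a) 0 (r_Proj n) \<phi> n"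
  proof
    show "span B \<noteq> (UNIV :: 'a set)" if "finite B" for B
      using inf that by (auto simp: r_infinite_dim_def)
    show "jproj P" if "P \<in> r_Proj n" for P
      using r_Proj_orth_proj[OF that] by (simp add: jproj_def linear_0[OF orth_proj_linear])
    show "span_proj B \<in> r_Proj n" if "jorthonormal B" "card B = n" for B
      using span_proj_in_r_Proj that by blast
  qed (use n \<phi> angle in \<open>auto simp: r_angle_eq_def\<close>)
  from angle_preserver_is_conjugation[OF this]
  show "\<exists>V W. linear V \<and> (\<forall>x. norm (V x) = norm x) \<and> (\<forall>x y. inner (V x) y = inner x (W y))
      \<and> (\<forall>P\<in>r_Proj n. \<phi> P = V \<circ> P \<circ> W)" by blast
next
  fix \<psi> :: "('b \<Rightarrow> 'b) \<Rightarrow> ('b \<Rightarrow> 'b)" and n :: nat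
  assume inf: "c_infinite_dim TYPE('b)" and n: "1 < n" and \<psi>: "\<forall>P\<in>c_Proj n. \<psi> P \<in> c_Proj n"
    and angle: "\<forall>P\<in>c_Proj n. \<forall>Q\<in>c_Proj n. c_angle_eq (\<psi> P) (\<psi> Q) P Q"
  interpret scalar_structure "\<lambda>x :: 'b. \<i> *\<^sub>C x" 1 by (rule scalar_structure_complex)
  have "angle_preserver (\<lambda>x :: 'b. \<i> *\<^sub>C x) 1 (c_Proj n) \<psi> n"
  proof
    show "span B \<noteq> (UNIV :: 'b set)" if "finite B" for B
      by (rule c_infinite_dim_real[OF inf that])
    show "jproj P" if "P \<in> c_Proj n" for P
      using c_Proj_orth_proj[OF that] by (simp add: jproj_def)
    show "span_proj B \<in> c_Proj n" if "jorthonormal B" "card B = n" for B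
      using span_proj_in_c_Proj that by blast
  qed (use n \<psi> angle in \<open>auto simp: c_angle_eq_def intro: c_equiv_imp_r_equiv\<close>)
  from angle_preserver_is_conjugation[OF this]
  obtain V W \<epsilon> where \<epsilon>: "\<epsilon> = 1 \<or> \<epsilon> = -1" and V: "linear V" "\<And>x. norm (V x) = norm x"
    "\<And>x. V (\<i> *\<^sub>C x) = \<epsilon> *\<^sub>R (\<i> *\<^sub>C V x)" "\<And>x y. inner (V x) y = inner x (W y)"
    "\<forall>P\<in>c_Proj n. \<psi> P = V \<circ> P \<circ> W" by blast
  \<comment> \<open>The real adjoint relation gives the real parts. The imaginary parts follow by
    replacing \<open>x\<close> with its multiple by \<open>\<i>\<close>, and the sign
    \<open>\<epsilon>\<close> decides whether a conjugation appears.\<close>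
  have "(c_linear V \<and> (\<forall>x y. cinner (V x) y = cinner x (W y)))
      \<or> (c_antilinear V \<and> (\<forall>x y. cinner (V x) y = cnj (cinner x (W y))))"
    using \<epsilon>
  proof
    assume "\<epsilon> = 1"
    then have VJ: "V (\<i> *\<^sub>C x) = \<i> *\<^sub>C V x" for x using V(3) by simp
    then have "c_linear V" using V(1) by (simp add: c_linear_iff)
    moreover have "cinner (V x) y = cinner x (W y)" for x y
      by (simp add: cinner_eq V(4) flip: VJ)
    ultimately show ?thesis by blast
  next
    assume "\<epsilon> = -1"
    then have VJ: "V (\<i> *\<^sub>C x) = - (\<i> *\<^sub>C V x)" for x using V(3) by simp
    then have "c_antilinear V" using V(1) by (intro c_antilinearI)
    moreover have "cinner (V x) y = cnj (cinner x (W y))" for x y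
    proof -
      have "inner (\<i> *\<^sub>C V x) y = - inner (V (\<i> *\<^sub>C x)) y" by (simp add: VJ)
      then show ?thesis by (simp add: cinner_eq complex_eq_iff V(4))
    qed
    ultimately show ?thesis by blast
  qed
  then show "\<exists>V W. (\<forall>x. norm (V x) = norm x)
      \<and> ((c_linear V \<and> (\<forall>x y. cinner (V x) y = cinner x (W y)))
        \<or> (c_antilinear V \<and> (\<forall>x y. cinner (V x) y = cnj (cinner x (W y)))))
      \<and> (\<forall>P\<in>c_Proj n. \<psi> P = V \<circ> P \<circ> W)"
    using V(2,5) by blast
qed

end
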